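(* Assume there are constants $\gamma_t\ge 0$ ($t=0,\dots,T-1$) with $|C_t(x)-C_t(y)|\le\gamma_t|x-y|$ for all $x,y$. Then for every $t=0,1,\dots,T-1$ and every $x\in\mathbb R$: $H_t(x)-H^*_t(x)\le\omega_t(x)$ and $V_t(x)-V^*_t(x)\le\bar\omega_t(x)$.
   Context: Model. Fix an integer horizon $T\ge 2$, a discount factor $\alpha\in(0,1]$, and for $t=0,\dots,T-1$: unit ordering costs $c_t\in\mathbb R$, a salvage coefficient $c_T\in\mathbb R$, setup costs $K_t\ge 0$, functions $G_t:\mathbb R\to\mathbb R$, and independent nonnegative random demands $D_0,\dots,D_{T-1}$ with right-continuous distribution functions $F_t$ and finite means; all expectations appearing are assumed finite. Let $\delta(z)=1$ for $z>0$, $\delta(0)=0$. Put $C_t(y)=(c_t-\alpha c_{t+1})y+G_t(y)+\alpha c_{t+1}E[D_t]$. Standing assumptions: (i) each $C_t$ is convex with $C_t(y)\to+\infty$ as $|y|\to\infty$; (ii) $K_t\ge \alpha K_{t+1}$ for $t=0,\dots,T-2$. Let $V^*_T\equiv 0$, and for $t=T-1,\dots,0$: $H^*_t(y)=C_t(y)+\alpha E[V^*_{t+1}(y-D_t)]$ and $V^*_t(x)=\min_{y\ge x}\{K_t\delta(y-x)+H^*_t(y)\}$. Grid construction. Fix $\theta>0$, $z_m=m\theta$, $Z_\theta=\{z_m:m\in\mathbb Z\}$, $f_t(n)=F_t(z_{n+1})-F_t(z_n)$ ($n\ge -1$). $C^m_t=\min\{y: C_t(y)=\min_x C_t(x)\}$;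 with $z_{n_0}<C^m_t\le z_{n_0+1}$, $S^U_t=\min\{z_m\in Z_\theta: z_m\ge C^m_t,\ C_t(z_m)>C_t(z_{n_0})+K_t\}$. $s_{T-1}$ is a point with $s_{T-1}\le C^m_{T-1}$, $C_{T-1}(s_{T-1})=C_{T-1}(C^m_{T-1})+K_{T-1}$; $\bar I_{T-1}=s_{T-1}$. For $t=T-2,\dots,0$: $I_t=\max\{z_m\in Z_\theta: z_m<\min(\bar I_{t+1}-\theta,C^m_t)\}$, $\bar I_t=\max\{z_m\in Z_\theta: z_m\le I_t,\ C_t(z_m)>C_t(I_t)+K_t\}+\theta$. $H_{T-1}=C_{T-1}$, $S_{T-1}=C^m_{T-1}$; $V_t(y)=H_t(S_t)+K_t$ for $y<s_t$, $V_t(y)=H_t(y)$ for $y\ge s_t$. For $t=T-2,\dots,0$: $H_t(y)=C_t(y)+\alpha\sum_{n=-1}^\infty V_{t+1}(y-z_n)f_t(n)$; $S_t=\max\{z_m\in Z_\theta: I_t\le z_m\le S^U_t,\ H_t(z_m)=\min\{H_t(z_n):z_n\in Z_\theta, I_t\le z_n\le S^U_t\}\}$; $s_t=S_t$ if $K_t=0$, else $s_t=\min\{z_m\in Z_\theta:\bar I_t\le z_m\le S_t,\ H_t(z_m)\le H_t(S_t)+K_t\}$. Estimate functions. $\psi_{T-1}(x,y)=\bar\psi_{T-1}(x,y)=\gamma_{T-1}x$; $\varphi_{T-1}(x,y)=\bar\varphi_{T-1}(x,y)=0$ if $y<s_{T-1}$ and $=\gamma_{T-1}x$ if $y\ge s_{T-1}$.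 For $t=0,\dots,T-2$, with $n$ the integer such that $z_{n-1}\le y-s_{t+1}<z_n$: $\psi_t(x,y)=\gamma_tx$ if $y<s_{t+1}-\theta$, else $\psi_t(x,y)=\gamma_tx+\alpha\sum_{m=-1}^{n-1}\varphi_{t+1}(x,y-z_m)f_t(m)$; $\varphi_t(x,y)=0$ if $y<s_t$, $=\psi_t(y-s_t,y)$ if $y\ge s_t$ and $y-x<s_t$, $=\psi_t(x,y)$ if $y\ge s_t$ and $y-x\ge s_t$. Likewise $\bar\psi_t(x,y)=\gamma_tx$ if $y<s_{t+1}-\theta$, else $\bar\psi_t(x,y)=\gamma_tx+\alpha\sum_{m=-1}^{n-1}\bar\varphi_{t+1}(x,y-z_m)f_t(m)$; $\bar\varphi_t(x,y)=0$ if $y<s_t$, $=\bar\psi_t(y-s_t+\theta,y)$ if $y\ge s_t$ and $y-x<s_t$, $=\bar\psi_t(x,y)$ if $y\ge s_t$ and $y-x\ge s_t$. Error-bound functions. $\omega_{T-1}\equiv\bar\omega_{T-1}\equiv 0$, $\eta_{T-1}=0$. For $t=T-2,\dots,0$: $\omega_t(x)=\psi_t(\theta,x)-\gamma_t\theta+\alpha\sum_{n=-1}^\infty\bar\omega_{t+1}(x-z_n)f_t(n)$; $\eta_t=\bar\psi_t(\theta,S^U_t)+\omega_t(S^U_t)$; $\bar\omega_t(x)=\eta_t$ if $x\le S^U_t$ and $\bar\omega_t(x)=\max(\eta_t,\omega_t(x))$ if $x>S^U_t$. *)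

theory Defs
  imports "HOL-Probability.Probability"
begin

text \<open>Conventions. Parameters are passed explicitly:
  T horizon, a discount factor alpha, K setup costs, C the functions C_t,
  F the distribution functions F_t, th the grid width theta, g the Lipschitz constants gamma_t,
  E t h the expectation E[h(D_t)].
  Recursions that run backwards in time are indexed by k = T-1-t (resp. T-t).\<close>

definition delta :: "real \<Rightarrow> real" where
  "delta z = (if z > 0 then 1 else 0)"

definition Cfun :: "real \<Rightarrow> (nat \<Rightarrow> real) \<Rightarrow> (nat \<Rightarrow> real \<Rightarrow> real) \<Rightarrow> 'a measure
    \<Rightarrow> (nat \<Rightarrow> 'a \<Rightarrow> real) \<Rightarrow> nat \<Rightarrow> real \<Rightarrow> real" where
  "Cfun a c G M D t y = (c t - a * c (Suc t)) * y + G t y + a * c (Suc t) * (\<integral>\<omega>. D t \<omega> \<partial>M)"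

definition Fdist :: "'a measure \<Rightarrow> (nat \<Rightarrow> 'a \<Rightarrow> real) \<Rightarrow> nat \<Rightarrow> real \<Rightarrow> real" where
  "Fdist M D t z = measure M {\<omega> \<in> space M. D t \<omega> \<le> z}"

definition Expt :: "'a measure \<Rightarrow> (nat \<Rightarrow> 'a \<Rightarrow> real) \<Rightarrow> nat \<Rightarrow> (real \<Rightarrow> real) \<Rightarrow> real" where
  "Expt M D t h = (\<integral>\<omega>. h (D t \<omega>) \<partial>M)"

primrec Vstar_aux :: "nat \<Rightarrow> real \<Rightarrow> (nat \<Rightarrow> real) \<Rightarrow> (nat \<Rightarrow> real \<Rightarrow> real)
    \<Rightarrow> (nat \<Rightarrow> (real \<Rightarrow> real) \<Rightarrow> real) \<Rightarrow> nat \<Rightarrow> real \<Rightarrow> real" where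
  "Vstar_aux T a K C E 0 = (\<lambda>x. 0)"
| "Vstar_aux T a K C E (Suc k) = (\<lambda>x. INF y\<in>{x..}. K (T - Suc k) * delta (y - x)
      + (C (T - Suc k) y + a * E (T - Suc k) (\<lambda>d. Vstar_aux T a K C E k (y - d))))"

definition Vstar :: "nat \<Rightarrow> real \<Rightarrow> (nat \<Rightarrow> real) \<Rightarrow> (nat \<Rightarrow> real \<Rightarrow> real)
    \<Rightarrow> (nat \<Rightarrow> (real \<Rightarrow> real) \<Rightarrow> real) \<Rightarrow> nat \<Rightarrow> real \<Rightarrow> real" where
  "Vstar T a K C E t = Vstar_aux T a K C E (T - t)"

definition Hstar :: "nat \<Rightarrow> real \<Rightarrow> (nat \<Rightarrow> real) \<Rightarrow> (nat \<Rightarrow> real \<Rightarrow> real)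
    \<Rightarrow> (nat \<Rightarrow> (real \<Rightarrow> real) \<Rightarrow> real) \<Rightarrow> nat \<Rightarrow> real \<Rightarrow> real" where
  "Hstar T a K C E t y = C t y + a * E t (\<lambda>d. Vstar T a K C E (Suc t) (y - d))"

definition zg :: "real \<Rightarrow> int \<Rightarrow> real" where
  "zg th m = of_int m * th"

definition fg :: "(nat \<Rightarrow> real \<Rightarrow> real) \<Rightarrow> real \<Rightarrow> nat \<Rightarrow> int \<Rightarrow> real" where
  "fg F th t n = F t (zg th (n + 1)) - F t (zg th n)"

definition Cmin :: "(nat \<Rightarrow> real \<Rightarrow> real) \<Rightarrow> nat \<Rightarrow> real" where
  "Cmin C t = Inf {y. C t y = (INF x. C t x)}"

definition n0 :: "(nat \<Rightarrow> real \<Rightarrow> real) \<Rightarrow> real \<Rightarrow> nat \<Rightarrow> int" where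
  "n0 C th t = (THE n. zg th n < Cmin C t \<and> Cmin C t \<le> zg th (n + 1))"

definition SU :: "(nat \<Rightarrow> real) \<Rightarrow> (nat \<Rightarrow> real \<Rightarrow> real) \<Rightarrow> real \<Rightarrow> nat \<Rightarrow> real" where
  "SU K C th t = Inf {zg th m | m. zg th m \<ge> Cmin C t
       \<and> C t (zg th m) > C t (zg th (n0 C th t)) + K t}"

definition sLast :: "nat \<Rightarrow> (nat \<Rightarrow> real) \<Rightarrow> (nat \<Rightarrow> real \<Rightarrow> real) \<Rightarrow> real" where
  "sLast T K C = (SOME s. s \<le> Cmin C (T - 1)
       \<and> C (T - 1) s = C (T - 1) (Cmin C (T - 1)) + K (T - 1))"

text \<open>I_t computed from t and Ibar_{t+1} (= b).\<close>
definition Ifrom :: "(nat \<Rightarrow> real \<Rightarrow> real) \<Rightarrow> real \<Rightarrow> nat \<Rightarrow> real \<Rightarrow> real" where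
  "Ifrom C th t b = Sup {zg th m | m. zg th m < min (b - th) (Cmin C t)}"

primrec Ibar_aux :: "nat \<Rightarrow> (nat \<Rightarrow> real) \<Rightarrow> (nat \<Rightarrow> real \<Rightarrow> real) \<Rightarrow> real \<Rightarrow> nat \<Rightarrow> real" where
  "Ibar_aux T K C th 0 = sLast T K C"
| "Ibar_aux T K C th (Suc k) =
     (let t = T - 2 - k; I = Ifrom C th t (Ibar_aux T K C th k)
      in Sup {zg th m | m. zg th m \<le> I \<and> C t (zg th m) > C t I + K t} + th)"

definition Ibar :: "nat \<Rightarrow> (nat \<Rightarrow> real) \<Rightarrow> (nat \<Rightarrow> real \<Rightarrow> real) \<Rightarrow> real \<Rightarrow> nat \<Rightarrow> real" where
  "Ibar T K C th t = Ibar_aux T K C th (T - 1 - t)"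

definition Ig :: "nat \<Rightarrow> (nat \<Rightarrow> real) \<Rightarrow> (nat \<Rightarrow> real \<Rightarrow> real) \<Rightarrow> real \<Rightarrow> nat \<Rightarrow> real" where
  "Ig T K C th t = Ifrom C th t (Ibar T K C th (Suc t))"

definition Vfrom :: "(real \<Rightarrow> real) \<Rightarrow> real \<Rightarrow> real \<Rightarrow> real \<Rightarrow> real \<Rightarrow> real" where
  "Vfrom H S s Kt y = (if y < s then H S + Kt else H y)"

primrec HSs_aux :: "nat \<Rightarrow> real \<Rightarrow> (nat \<Rightarrow> real) \<Rightarrow> (nat \<Rightarrow> real \<Rightarrow> real) \<Rightarrow> (nat \<Rightarrow> real \<Rightarrow> real)
    \<Rightarrow> real \<Rightarrow> nat \<Rightarrow> (real \<Rightarrow> real) \<times> real \<times> real" where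
  "HSs_aux T a K C F th 0 = (C (T - 1), Cmin C (T - 1), sLast T K C)"
| "HSs_aux T a K C F th (Suc k) =
     (let t = T - 2 - k;
          (H', S', s') = HSs_aux T a K C F th k;
          H = (\<lambda>y. C t y + a * (\<Sum>n. Vfrom H' S' s' (K (Suc t)) (y - zg th (int n - 1))
                                      * fg F th t (int n - 1)));
          Gr = {zg th m | m. Ig T K C th t \<le> zg th m \<and> zg th m \<le> SU K C th t};
          S = Max {x \<in> Gr. H x = Min (H ` Gr)};
          s = (if K t = 0 then S
               else Min {zg th m | m. Ibar T K C th t \<le> zg th m \<and> zg th m \<le> S
                                       \<and> H (zg th m) \<le> H S + K t})
      in (H, S, s))"

definition Hg where "Hg T a K C F th t = fst (HSs_aux T a K C F th (T - 1 - t))"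
definition Sg where "Sg T a K C F th t = fst (snd (HSs_aux T a K C F th (T - 1 - t)))"
definition sg where "sg T a K C F th t = snd (snd (HSs_aux T a K C F th (T - 1 - t)))"
definition Vg :: "nat \<Rightarrow> real \<Rightarrow> (nat \<Rightarrow> real) \<Rightarrow> (nat \<Rightarrow> real \<Rightarrow> real) \<Rightarrow> (nat \<Rightarrow> real \<Rightarrow> real)
    \<Rightarrow> real \<Rightarrow> nat \<Rightarrow> real \<Rightarrow> real" where
  "Vg T a K C F th t y = Vfrom (Hg T a K C F th t) (Sg T a K C F th t) (sg T a K C F th t) (K t) y"

definition nidx :: "real \<Rightarrow> real \<Rightarrow> real \<Rightarrow> int" where
  "nidx th s y = (THE n. zg th (n - 1) \<le> y - s \<and> y - s < zg th n)"

text \<open>psi_t (or psibar_t) from phi_{t+1} (resp. phibar_{t+1}) = phin.\<close>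
definition psi_from :: "nat \<Rightarrow> real \<Rightarrow> (nat \<Rightarrow> real) \<Rightarrow> (nat \<Rightarrow> real \<Rightarrow> real) \<Rightarrow> (nat \<Rightarrow> real \<Rightarrow> real)
    \<Rightarrow> real \<Rightarrow> (nat \<Rightarrow> real) \<Rightarrow> nat \<Rightarrow> (real \<Rightarrow> real \<Rightarrow> real) \<Rightarrow> real \<Rightarrow> real \<Rightarrow> real" where
  "psi_from T a K C F th g t phin x y =
     (let s1 = sg T a K C F th (Suc t) in
      if y < s1 - th then g t * x
      else g t * x + a * (\<Sum>m\<in>{-1..nidx th s1 y - 1}. phin x (y - zg th m) * fg F th t m))"

definition phi_from :: "nat \<Rightarrow> real \<Rightarrow> (nat \<Rightarrow> real) \<Rightarrow> (nat \<Rightarrow> real \<Rightarrow> real) \<Rightarrow> (nat \<Rightarrow> real \<Rightarrow> real)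
    \<Rightarrow> real \<Rightarrow> nat \<Rightarrow> (real \<Rightarrow> real \<Rightarrow> real) \<Rightarrow> real \<Rightarrow> real \<Rightarrow> real" where
  "phi_from T a K C F th t psi x y =
     (let s = sg T a K C F th t in
      if y < s then 0 else if y - x < s then psi (y - s) y else psi x y)"

definition phibar_from :: "nat \<Rightarrow> real \<Rightarrow> (nat \<Rightarrow> real) \<Rightarrow> (nat \<Rightarrow> real \<Rightarrow> real) \<Rightarrow> (nat \<Rightarrow> real \<Rightarrow> real)
    \<Rightarrow> real \<Rightarrow> nat \<Rightarrow> (real \<Rightarrow> real \<Rightarrow> real) \<Rightarrow> real \<Rightarrow> real \<Rightarrow> real" where
  "phibar_from T a K C F th t psi x y =
     (let s = sg T a K C F th t in
      if y < s then 0 else if y - x < s then psi (y - s + th) y else psi x y)"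

primrec phi_aux :: "nat \<Rightarrow> real \<Rightarrow> (nat \<Rightarrow> real) \<Rightarrow> (nat \<Rightarrow> real \<Rightarrow> real) \<Rightarrow> (nat \<Rightarrow> real \<Rightarrow> real)
    \<Rightarrow> real \<Rightarrow> (nat \<Rightarrow> real) \<Rightarrow> nat \<Rightarrow> real \<Rightarrow> real \<Rightarrow> real" where
  "phi_aux T a K C F th g 0 =
     (\<lambda>x y. if y < sg T a K C F th (T - 1) then 0 else g (T - 1) * x)"
| "phi_aux T a K C F th g (Suc k) =
     phi_from T a K C F th (T - 2 - k)
       (psi_from T a K C F th g (T - 2 - k) (phi_aux T a K C F th g k))"

primrec phibar_aux :: "nat \<Rightarrow> real \<Rightarrow> (nat \<Rightarrow> real) \<Rightarrow> (nat \<Rightarrow> real \<Rightarrow> real) \<Rightarrow> (nat \<Rightarrow> real \<Rightarrow> real)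
    \<Rightarrow> real \<Rightarrow> (nat \<Rightarrow> real) \<Rightarrow> nat \<Rightarrow> real \<Rightarrow> real \<Rightarrow> real" where
  "phibar_aux T a K C F th g 0 =
     (\<lambda>x y. if y < sg T a K C F th (T - 1) then 0 else g (T - 1) * x)"
| "phibar_aux T a K C F th g (Suc k) =
     phibar_from T a K C F th (T - 2 - k)
       (psi_from T a K C F th g (T - 2 - k) (phibar_aux T a K C F th g k))"

definition phi where "phi T a K C F th g t = phi_aux T a K C F th g (T - 1 - t)"
definition phibar where "phibar T a K C F th g t = phibar_aux T a K C F th g (T - 1 - t)"

definition psi :: "nat \<Rightarrow> real \<Rightarrow> (nat \<Rightarrow> real) \<Rightarrow> (nat \<Rightarrow> real \<Rightarrow> real) \<Rightarrow> (nat \<Rightarrow> real \<Rightarrow> real)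
    \<Rightarrow> real \<Rightarrow> (nat \<Rightarrow> real) \<Rightarrow> nat \<Rightarrow> real \<Rightarrow> real \<Rightarrow> real" where
  "psi T a K C F th g t = (if t = T - 1 then (\<lambda>x y. g t * x)
     else psi_from T a K C F th g t (phi T a K C F th g (Suc t)))"

definition psibar :: "nat \<Rightarrow> real \<Rightarrow> (nat \<Rightarrow> real) \<Rightarrow> (nat \<Rightarrow> real \<Rightarrow> real) \<Rightarrow> (nat \<Rightarrow> real \<Rightarrow> real)
    \<Rightarrow> real \<Rightarrow> (nat \<Rightarrow> real) \<Rightarrow> nat \<Rightarrow> real \<Rightarrow> real \<Rightarrow> real" where
  "psibar T a K C F th g t = (if t = T - 1 then (\<lambda>x y. g t * x)
     else psi_from T a K C F th g t (phibar T a K C F th g (Suc t)))"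

text \<open>omega_t from omegabar_{t+1} = wb.\<close>
definition omega_from :: "nat \<Rightarrow> real \<Rightarrow> (nat \<Rightarrow> real) \<Rightarrow> (nat \<Rightarrow> real \<Rightarrow> real) \<Rightarrow> (nat \<Rightarrow> real \<Rightarrow> real)
    \<Rightarrow> real \<Rightarrow> (nat \<Rightarrow> real) \<Rightarrow> nat \<Rightarrow> (real \<Rightarrow> real) \<Rightarrow> real \<Rightarrow> real" where
  "omega_from T a K C F th g t wb x =
     psi T a K C F th g t th x - g t * th
     + a * (\<Sum>n. wb (x - zg th (int n - 1)) * fg F th t (int n - 1))"

primrec omegabar_aux :: "nat \<Rightarrow> real \<Rightarrow> (nat \<Rightarrow> real) \<Rightarrow> (nat \<Rightarrow> real \<Rightarrow> real) \<Rightarrow> (nat \<Rightarrow> real \<Rightarrow> real)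
    \<Rightarrow> real \<Rightarrow> (nat \<Rightarrow> real) \<Rightarrow> nat \<Rightarrow> real \<Rightarrow> real" where
  "omegabar_aux T a K C F th g 0 = (\<lambda>x. 0)"
| "omegabar_aux T a K C F th g (Suc k) =
     (let t = T - 2 - k;
          w = omega_from T a K C F th g t (omegabar_aux T a K C F th g k);
          eta = psibar T a K C F th g t th (SU K C th t) + w (SU K C th t)
      in (\<lambda>x. if x \<le> SU K C th t then eta else max eta (w x)))"

definition omegabar where "omegabar T a K C F th g t = omegabar_aux T a K C F th g (T - 1 - t)"

definition omega :: "nat \<Rightarrow> real \<Rightarrow> (nat \<Rightarrow> real) \<Rightarrow> (nat \<Rightarrow> real \<Rightarrow> real) \<Rightarrow> (nat \<Rightarrow> real \<Rightarrow> real)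
    \<Rightarrow> real \<Rightarrow> (nat \<Rightarrow> real) \<Rightarrow> nat \<Rightarrow> real \<Rightarrow> real" where
  "omega T a K C F th g t = (if t = T - 1 then (\<lambda>x. 0)
     else omega_from T a K C F th g t (omegabar T a K C F th g (Suc t)))"

end

theory Submission
  imports Defs
begin

text \<open>The key step bounds the loss of using the grid policy in \<open>H\<^sub>t\<close> itself: for \<open>x \<le> y \<le> S\<^sup>U\<^sub>t\<close>,
  \<open>V\<^sub>t(x) \<le> K\<^sub>t \<delta>(y - x) + H\<^sub>t(y) + \<psi>b\<^sub>t(\<theta>, S\<^sup>U\<^sub>t)\<close>, where \<open>\<psi>b\<close> is the barred \<open>\<psi>\<close>.
  On the grid, \<open>H\<^sub>t\<close> and \<open>V\<^sub>t\<close> are \<open>K\<^sub>t\<close>-convex, so there the policy is optimal. Off the grid one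
  uses the cell estimate \<open>\<bar>2 H\<^sub>t(x) - H\<^sub>t(z\<^sub>i) - H\<^sub>t(z\<^sub>i\<^sub>+\<^sub>1)\<bar> \<le> \<psi>b\<^sub>t(\<theta>, z\<^sub>i\<^sub>+\<^sub>1)\<close> for
  \<open>z\<^sub>i \<le> x \<le> z\<^sub>i\<^sub>+\<^sub>1\<close>, which the recursion preserves because \<open>s\<^sub>t\<close> lies on the grid for
  \<open>t \<le> T - 2\<close>; note that \<open>\<psi>b\<^sub>t(\<theta>, \<cdot>)\<close> is monotone on the grid but not on the reals.
  The discretization error \<open>V\<^sub>t\<^sub>+\<^sub>1(x - z\<^sub>n) - V\<^sub>t\<^sub>+\<^sub>1(x - D\<^sub>t)\<close> is at most
  \<open>\<phi>\<^sub>t\<^sub>+\<^sub>1(\<theta>, x - z\<^sub>n)\<close>. For the exact problem, \<open>V\<^sup>*\<^sub>t(x) \<le> K\<^sub>t + V\<^sup>*\<^sub>t(y)\<close> for \<open>x \<le> y\<close>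
  already implies that ordering is never better than not ordering above \<open>C\<^sup>m\<^sub>t\<close>, and that orders up to a
  level above \<open>S\<^sup>U\<^sub>t\<close> can be ignored.\<close>

subsection \<open>Grid points\<close>

lemma zg_plus1: "zg th (i + 1) = zg th i + th"
  by (simp add: zg_def algebra_simps)

lemma zg_mono: "0 < th \<Longrightarrow> zg th i \<le> zg th j \<longleftrightarrow> i \<le> j"
  by (simp add: zg_def)

lemma zg_less: "0 < th \<Longrightarrow> zg th i < zg th j \<longleftrightarrow> i < j"
  by (simp add: zg_def)

lemma zg_diff: "zg th i - zg th j = zg th (i - j)"
  by (simp add: zg_def algebra_simps)

lemma zg_floor:
  assumes "0 < th"
  obtains i where "zg th i \<le> x" "x < zg th (i + 1)"
proof
  show "zg th \<lfloor>x / th\<rfloor> \<le> x" "x < zg th (\<lfloor>x / th\<rfloor> + 1)"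
    using floor_divide_lower[OF assms] floor_divide_upper[OF assms] by (auto simp: zg_def)
qed

lemma zg_ceiling:
  assumes "0 < th"
  obtains i where "zg th i < x" "x \<le> zg th (i + 1)"
proof
  show "zg th (\<lceil>x / th\<rceil> - 1) < x" "x \<le> zg th (\<lceil>x / th\<rceil> - 1 + 1)"
    using ceiling_divide_lower[OF assms] ceiling_divide_upper[OF assms] by (auto simp: zg_def)
qed

text \<open>Distinct grid points are at least \<open>th\<close> apart, so an element within
  \<open>th\<close> of the supremum is already the maximum.\<close>

lemma grid_Sup_mem:
  assumes th: "0 < th" and X: "X \<subseteq> range (zg th)" "X \<noteq> {}" "bdd_above X"
  shows "Sup X \<in> X"
proof -
  obtain x where x: "x \<in> X" "Sup X - th < x"
    using less_cSup_iff[OF X(2,3), of "Sup X - th"] th by auto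
  have "y \<le> x" if yX: "y \<in> X" for y
  proof -
    obtain i j where ij: "x = zg th i" "y = zg th j" using x(1) yX X(1) by (metis imageE subsetD)
    have "zg th j < zg th (i + 1)"
      using cSup_upper[OF yX X(3)] x ij by (simp add: zg_plus1)
    then show ?thesis using th ij by (simp add: zg_less zg_mono)
  qed
  then show ?thesis using x cSup_eq_maximum by metis
qed

lemma grid_Inf_mem:
  assumes th: "0 < th" and X: "X \<subseteq> range (zg th)" "X \<noteq> {}" "bdd_below X"
  shows "Inf X \<in> X"
proof -
  obtain x where x: "x \<in> X" "x < Inf X + th"
    using cInf_less_iff[OF X(2,3), of "Inf X + th"] th by auto
  have "x \<le> y" if yX: "y \<in> X" for y
  proof -
    obtain i j where ij: "x = zg th i" "y = zg th j" using x(1) yX X(1) by (metis imageE subsetD)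
    have "zg th i < zg th (j + 1)"
      using cInf_lower[OF yX X(3)] x ij by (simp add: zg_plus1)
    then show ?thesis using th ij by (simp add: zg_less zg_mono)
  qed
  then show ?thesis using x cInf_eq_minimum by metis
qed

lemma finite_grid_Icc:
  assumes "0 < th"
  shows "finite {zg th m | m. u \<le> zg th m \<and> zg th m \<le> v}"
proof -
  have "{zg th m | m. u \<le> zg th m \<and> zg th m \<le> v} \<subseteq> zg th ` {\<lceil>u / th\<rceil>..\<lfloor>v / th\<rfloor>}"
    using assms by (auto simp: zg_def ceiling_le_iff le_floor_iff field_simps)
  then show ?thesis by (rule finite_subset) simp
qed

lemma nidx_eq:
  assumes "0 < th"
  shows "nidx th s y = \<lfloor>(y - s) / th\<rfloor> + 1"
  unfolding nidx_def
proof (rule the_equality)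
  show "zg th (\<lfloor>(y - s) / th\<rfloor> + 1 - 1) \<le> y - s \<and> y - s < zg th (\<lfloor>(y - s) / th\<rfloor> + 1)"
    using floor_divide_lower[OF assms] floor_divide_upper[OF assms] by (auto simp: zg_def)
next
  fix n assume "zg th (n - 1) \<le> y - s \<and> y - s < zg th n"
  then have "\<lfloor>(y - s) / th\<rfloor> = n - 1"
    using assms by (intro floor_unique) (auto simp: zg_def field_simps)
  then show "n = \<lfloor>(y - s) / th\<rfloor> + 1" by simp
qed

subsection \<open>K-convexity\<close>

text \<open>Scarf's K-convexity with denominators cleared, so that \<open>x = z\<close> needs no
  separate treatment. It is relative to a set because the invariant holds on all reals only at the
  last stage and on the grid at earlier ones.\<close>

definition kconvex_on :: "real set \<Rightarrow> real \<Rightarrow> (real \<Rightarrow> real) \<Rightarrow> bool" where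
  "kconvex_on A K f \<longleftrightarrow> (\<forall>x\<in>A. \<forall>y\<in>A. \<forall>z\<in>A. x \<le> y \<longrightarrow> y \<le> z \<longrightarrow>
     (z - x) * f y \<le> (z - y) * f x + (y - x) * (K + f z))"

lemma kconvex_onD:
  "kconvex_on A K f \<Longrightarrow> x \<in> A \<Longrightarrow> y \<in> A \<Longrightarrow> z \<in> A \<Longrightarrow> x \<le> y \<Longrightarrow> y \<le> z \<Longrightarrow>
     (z - x) * f y \<le> (z - y) * f x + (y - x) * (K + f z)"
  by (simp add: kconvex_on_def)

lemma kconvex_on_subset: "kconvex_on A K f \<Longrightarrow> B \<subseteq> A \<Longrightarrow> kconvex_on B K f"
  unfolding kconvex_on_def by blast

lemma convex_imp_kconvex:
  assumes f: "convex_on UNIV f" and K: "0 \<le> K"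
  shows "kconvex_on A K f"
  unfolding kconvex_on_def
proof (intro ballI impI)
  fix x y z :: real assume xyz: "x \<le> y" "y \<le> z"
  show "(z - x) * f y \<le> (z - y) * f x + (y - x) * (K + f z)"
  proof (cases "x = z")
    case False
    then have pos: "0 < z - x" using xyz by simp
    define u where "u = (y - x) / (z - x)"
    have u: "0 \<le> u" "u \<le> 1" using xyz pos by (auto simp: u_def)
    have "u * (z - x) = y - x" using pos by (simp add: u_def)
    then have "(1 - u) * x + u * z = y" by (simp add: algebra_simps)
    then have "f y \<le> (1 - u) * f x + u * f z"
      using convex_onD[OF f u, of x z] by simp
    then have "(z - x) * f y \<le> (z - x) * ((1 - u) * f x + u * f z)"
      using pos by (intro mult_left_mono) auto
    also have "\<dots> = ((z - x) - u * (z - x)) * f x + u * (z - x) * f z"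
      by (simp add: algebra_simps)
    also have "\<dots> = (z - y) * f x + (y - x) * f z"
      using pos by (simp add: u_def)
    also have "\<dots> \<le> (z - y) * f x + (y - x) * (K + f z)"
      using K xyz by (intro add_left_mono mult_left_mono) auto
    finally show ?thesis .
  qed (use xyz in auto)
qed

text \<open>If \<open>H x\<close> exceeds \<open>H S + K\<close>, it also exceeds
  \<open>H s\<close>; putting \<open>H x\<close> in place of \<open>H s\<close> in the K-convexity
  inequality for \<open>s\<close>, \<open>x\<close>, \<open>y\<close> leaves the claim times
  \<open>x - s\<close>. Only the value \<open>H S\<close> matters, so \<open>S\<close> may lie
  outside \<open>A\<close>.\<close>

lemma kconvex_no_order:
  assumes kc: "kconvex_on A K H" and A: "s \<in> A" "x \<in> A" "y \<in> A" and ord: "s \<le> x" "x \<le> y"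
    and s: "H s \<le> H S + K" and min: "H S \<le> H y"
  shows "H x \<le> K + H y"
proof (cases "H x \<le> H S + K")
  case False
  then have sx: "s < x" using s ord by (cases "s = x") auto
  have "(y - s) * H x \<le> (y - x) * H s + (x - s) * (K + H y)"
    using kconvex_onD[OF kc] A ord by blast
  also have "\<dots> \<le> (y - x) * H x + (x - s) * (K + H y)"
    using s False ord by (intro add_right_mono mult_left_mono) auto
  finally have "(x - s) * H x \<le> (x - s) * (K + H y)" by (simp add: algebra_simps)
  then show ?thesis using sx by simp
qed (use min in simp)

lemma Vfrom_le:
  assumes kc: "kconvex_on A K H" and A: "s \<in> A" "x \<in> A" "y \<in> A" and ord: "x \<le> y" and K: "0 \<le> K"
    and s: "H s \<le> H S + K" and min: "\<And>z. z \<in> A \<Longrightarrow> H S \<le> H z"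
  shows "Vfrom H S s K x \<le> K + Vfrom H S s K y"
  using kconvex_no_order[OF kc A _ ord s min[OF A(3)]] min[OF A(3)] ord K
  by (auto simp: Vfrom_def)

text \<open>Scarf's preservation argument for an (s, S) policy, on a set \<open>A\<close> that need
  not be an interval.\<close>

lemma kconvex_Vfrom:
  assumes kc: "kconvex_on A K H" and sA: "s \<in> A" and K: "0 \<le> K"
    and s: "H s \<le> H S + K" and min: "\<And>z. z \<in> A \<Longrightarrow> H S \<le> H z"
  shows "kconvex_on A K (Vfrom H S s K)"
  unfolding kconvex_on_def
proof (intro ballI impI)
  fix x y z assume A: "x \<in> A" "y \<in> A" "z \<in> A" and ord: "x \<le> y" "y \<le> z"
  let ?V = "Vfrom H S s K"
  have yz: "?V y \<le> K + ?V z" using Vfrom_le[OF kc sA A(2,3) ord(2) K s min] .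
  consider "s \<le> x" | "x < s" "y < s" | "x < s" "s \<le> y" by linarith
  then show "(z - x) * ?V y \<le> (z - y) * ?V x + (y - x) * (K + ?V z)"
  proof cases
    case 1
    then show ?thesis using kconvex_onD[OF kc A ord] ord by (simp add: Vfrom_def)
  next
    case 2
    then have "?V x = ?V y" by (simp add: Vfrom_def)
    moreover have "(y - x) * ?V y \<le> (y - x) * (K + ?V z)"
      using yz ord by (intro mult_left_mono) auto
    ultimately show ?thesis by (simp add: algebra_simps)
  next
    case 3
    then have V: "?V x = H S + K" "?V y = H y" "?V z = H z" using ord by (auto simp: Vfrom_def)
    \<comment> \<open>The weight \<open>z - x\<close> is split at \<open>s\<close>: the part
      \<open>s - x\<close> uses the bound by \<open>K\<close>, the part \<open>z - s\<close> uses
      K-convexity from \<open>s\<close> onward.\<close>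
    have "(s - x) * H y \<le> (s - x) * (K + H z)"
      using yz V 3 by (intro mult_left_mono) auto
    moreover have "(z - s) * H y \<le> (z - y) * H s + (y - s) * (K + H z)"
      using kconvex_onD[OF kc sA A(2,3) _ ord(2)] 3 by simp
    moreover have "(z - y) * H s \<le> (z - y) * (H S + K)"
      using s ord by (intro mult_left_mono) auto
    ultimately show ?thesis unfolding V by (simp add: algebra_simps)
  qed
qed

section \<open>Convex coercive functions and their minimizers\<close>

lemma convex_increasing_right:
  fixes f :: "real \<Rightarrow> real"
  assumes f: "convex_on UNIV f" and m: "\<And>x. f m \<le> f x" and ord: "m \<le> x" "x \<le> y"
  shows "f x \<le> f y"
  \<comment> \<open>A convex function is 0-convex, and the minimizer \<open>m\<close> plays the
    roles of both \<open>s\<close> and \<open>S\<close>.\<close>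
  using kconvex_no_order[OF convex_imp_kconvex[OF f, of 0 UNIV], of m x y m] m ord by simp

lemma convex_decreasing_left:
  fixes f :: "real \<Rightarrow> real"
  assumes f: "convex_on UNIV f" and m: "\<And>x. f m \<le> f x" and ord: "x \<le> y" "y \<le> m"
  shows "f y \<le> f x"
proof (cases "x = m")
  case False
  have "(m - x) * f y \<le> (m - y) * f x + (y - x) * (0 + f m)"
    using kconvex_onD[OF convex_imp_kconvex[OF f, of 0 UNIV], of x y m] ord by simp
  also have "\<dots> \<le> (m - y) * f x + (y - x) * f x"
    using m ord by (intro add_mono mult_left_mono) auto
  finally have "(m - x) * f y \<le> (m - x) * f x" by (simp add: algebra_simps)
  then show ?thesis using False ord by simp
qed (use ord in simp)

text \<open>Coercivity confines the search to a compact interval; the set of minimizers is then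
  nonempty, closed and bounded below, so it contains its infimum.\<close>

lemma coercive_argmin_Inf:
  fixes f :: "real \<Rightarrow> real"
  assumes cont: "continuous_on UNIV f" and top: "filterlim f at_top at_top"
    and bot: "filterlim f at_top at_bot"
  defines "m \<equiv> Inf {y. f y = (INF x. f x)}"
  shows "f m \<le> f x"
proof -
  obtain B where B: "\<And>x. B \<le> x \<Longrightarrow> f 0 + 1 \<le> f x"
    using top[unfolded filterlim_at_top] by (auto simp: eventually_at_top_linorder)
  obtain b where b: "\<And>x. x \<le> b \<Longrightarrow> f 0 + 1 \<le> f x"
    using bot[unfolded filterlim_at_top] by (auto simp: eventually_at_bot_linorder)
  have "0 < B" "b < 0" using B[of 0] b[of 0] by force+
  then obtain p where p: "p \<in> {b..B}" "\<And>x. x \<in> {b..B} \<Longrightarrow> f p \<le> f x"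
    using continuous_attains_inf[of "{b..B}" f] continuous_on_subset[OF cont] by auto
  have p0: "f p \<le> f 0" using p(2)[of 0] \<open>0 < B\<close> \<open>b < 0\<close> by simp
  have pmin: "f p \<le> f x" for x
    using p(2)[of x] B[of x] b[of x] p0 by fastforce
  have inf: "(INF x. f x) = f p"
    by (rule cInf_eq_minimum) (auto intro: pmin)
  let ?Y = "{y. f y = (INF x. f x)}"
  have "closed ?Y"
    using closed_Collect_eq[of f "\<lambda>_. INF x. f x"] cont by simp
  moreover have "p \<in> ?Y" by (simp add: inf)
  moreover have "bdd_below ?Y"
  proof (rule bdd_belowI)
    show "b \<le> y" if "y \<in> ?Y" for y
      using b[of y] that inf p0 by force
  qed
  ultimately have "m \<in> ?Y" unfolding m_def by (intro closed_contains_Inf) auto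
  then show ?thesis using pmin inf by simp
qed

subsection \<open>The grid construction\<close>

text \<open>Constancy near minus infinity. As \<open>y - z n\<close> tends to minus infinity with
  growing \<open>n\<close>, this makes the weighted series converge without a growth condition on
  the other side.\<close>

definition left_const :: "(real \<Rightarrow> real) \<Rightarrow> bool" where
  "left_const q \<longleftrightarrow> (\<exists>b c. \<forall>u<b. q u = c)"

text \<open>The grid recursion sees the demand only through the cell weights, so the demand is
  represented here by weights that are nonnegative and sum to 1.\<close>

locale grid_dp =
  fixes T :: nat and a :: real and K :: "nat \<Rightarrow> real" and C :: "nat \<Rightarrow> real \<Rightarrow> real"
    and F :: "nat \<Rightarrow> real \<Rightarrow> real" and th :: real and g :: "nat \<Rightarrow> real"
  assumes T2: "2 \<le> T"
    and a_pos: "0 < a"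
    and K_nonneg: "t < T \<Longrightarrow> 0 \<le> K t"
    and K_dec: "Suc t < T \<Longrightarrow> a * K (Suc t) \<le> K t"
    and C_convex: "t < T \<Longrightarrow> convex_on UNIV (C t)"
    and C_top: "t < T \<Longrightarrow> filterlim (C t) at_top at_top"
    and C_bot: "t < T \<Longrightarrow> filterlim (C t) at_top at_bot"
    and th_pos: "0 < th"
    and g_nonneg: "t < T \<Longrightarrow> 0 \<le> g t"
    and C_lip: "t < T \<Longrightarrow> \<bar>C t x - C t y\<bar> \<le> g t * \<bar>x - y\<bar>"
    and F_nonneg: "t < T \<Longrightarrow> 0 \<le> fg F th t n"
    and F_sums: "t < T \<Longrightarrow> (\<lambda>n. fg F th t (int n - 1)) sums 1"
begin

section \<open>Notation and averages over the discretized demand\<close>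

abbreviation "z \<equiv> zg th"
abbreviation "Z \<equiv> range (zg th)"
abbreviation "m t \<equiv> Cmin C t"
abbreviation "U t \<equiv> SU K C th t"
abbreviation "Ib t \<equiv> Ibar T K C th t"
abbreviation "I t \<equiv> Ig T K C th t"
abbreviation "H t \<equiv> Hg T a K C F th t"
abbreviation "S t \<equiv> Sg T a K C F th t"
abbreviation "s t \<equiv> sg T a K C F th t"
abbreviation "V t \<equiv> Vg T a K C F th t"
abbreviation "\<phi> t \<equiv> phi T a K C F th g t"
abbreviation "\<phi>b t \<equiv> phibar T a K C F th g t"
abbreviation "\<psi> t \<equiv> psi T a K C F th g t"
abbreviation "\<psi>b t \<equiv> psibar T a K C F th g t"
abbreviation "\<omega> t \<equiv> omega T a K C F th g t"
abbreviation "\<omega>b t \<equiv> omegabar T a K C F th g t"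

text \<open>Expectation of \<open>q\<close> after demand when demand in the cell from
  \<open>z n\<close> (excluded) to \<open>z (n + 1)\<close> (included) is rounded down to
  \<open>z n\<close>. The index starts at -1 so that the cell ending at 0 catches zero
  demand.\<close>

definition av :: "nat \<Rightarrow> (real \<Rightarrow> real) \<Rightarrow> real \<Rightarrow> real" where
  "av t q y = (\<Sum>n. q (y - z (int n - 1)) * fg F th t (int n - 1))"

lemma eventually_below:
  "\<exists>N. \<forall>n\<ge>N. y - z (int n - 1) < b"
proof -
  obtain N where N: "(y - b) / th + 1 < real N" using reals_Archimedean2 by blast
  have "y - z (int n - 1) < b" if "N \<le> n" for n
  proof -
    have "(y - b) / th < real n - 1" using N that by linarith
    then show ?thesis using th_pos by (simp add: zg_def field_simps)
  qed
  then show ?thesis by blast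
qed

lemma av_summable:
  assumes t: "t < T" and q: "left_const q"
  shows "summable (\<lambda>n. q (y - z (int n - 1)) * fg F th t (int n - 1))"
proof -
  obtain b c where c: "\<And>u. u < b \<Longrightarrow> q u = c" using q by (auto simp: left_const_def)
  obtain N where N: "\<And>n. n \<ge> N \<Longrightarrow> y - z (int n - 1) < b" using eventually_below by blast
  have "summable (\<lambda>n. c * fg F th t (int n - 1))"
    using F_sums[OF t] by (intro summable_mult) (auto simp: sums_iff)
  moreover have "\<forall>\<^sub>F n in sequentially. q (y - z (int n - 1)) * fg F th t (int n - 1) = c * fg F th t (int n - 1)"
    using N c by (auto simp: eventually_sequentially)
  ultimately show ?thesis using summable_cong by fast
qed

lemma av_sums:
  "t < T \<Longrightarrow> left_const q \<Longrightarrow>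
     (\<lambda>n. q (y - z (int n - 1)) * fg F th t (int n - 1)) sums av t q y"
  unfolding av_def by (intro summable_sums av_summable)

lemma av_const: "t < T \<Longrightarrow> av t (\<lambda>_. c) y = c"
  using sums_mult[OF F_sums, of t c] by (simp add: av_def sums_iff)

lemma av_mono:
  assumes t: "t < T" and q: "left_const p" "left_const q"
    and le: "\<And>n. p (x - z n) \<le> q (y - z n)"
  shows "av t p x \<le> av t q y"
  by (rule sums_le[OF _ av_sums[OF t q(1)] av_sums[OF t q(2)]])
     (intro mult_right_mono le F_nonneg t)

lemma av_cong:
  assumes "\<And>n. -1 \<le> n \<Longrightarrow> p (x - z n) = q (y - z n)"
  shows "av t p x = av t q y"
  unfolding av_def using assms by simp

lemma av_le_add:
  assumes t: "t < T" and q: "left_const p" "left_const q" "left_const r"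
    and le: "\<And>n. p (x - z n) \<le> q (y - z n) + r (y' - z n)"
  shows "av t p x \<le> av t q y + av t r y'"
proof (rule sums_le[OF _ av_sums[OF t q(1)] sums_add[OF av_sums[OF t q(2)] av_sums[OF t q(3)]]])
  show "p (x - z (int n - 1)) * fg F th t (int n - 1)
      \<le> q (y - z (int n - 1)) * fg F th t (int n - 1) + r (y' - z (int n - 1)) * fg F th t (int n - 1)" for n
    using mult_right_mono[OF le F_nonneg[OF t]] by (simp add: distrib_right)
qed

lemma left_constI: "(\<And>u. u < b \<Longrightarrow> q u = c) \<Longrightarrow> left_const q"
  unfolding left_const_def by blast

lemma left_const_V: "left_const (V t)"
  by (rule left_constI[of "s t"]) (simp add: Vg_def Vfrom_def)

lemma Z_add: "x \<in> Z \<Longrightarrow> x - z n \<in> Z" "x \<in> Z \<Longrightarrow> x + th \<in> Z" "x \<in> Z \<Longrightarrow> x - th \<in> Z"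
proof -
  assume "x \<in> Z"
  then obtain i where i: "x = z i" by blast
  have "x - z n = z (i - n)" "x + th = z (i + 1)" "x - th = z (i - 1)"
    using i by (simp_all add: zg_def algebra_simps)
  then show "x - z n \<in> Z" "x + th \<in> Z" "x - th \<in> Z" by auto
qed

lemma Z_less: "x \<in> Z \<Longrightarrow> y \<in> Z \<Longrightarrow> x < y + th \<Longrightarrow> x \<le> y"
  using th_pos by (auto simp flip: zg_plus1 simp: zg_less zg_mono)

section \<open>Well-definedness of the critical levels\<close>

lemma C_cont: "t < T \<Longrightarrow> continuous_on UNIV (C t)"
proof (rule lipschitz_on_continuous_on)
  assume "t < T"
  then show "lipschitz_on (g t) UNIV (C t)"
    by (intro lipschitz_onI) (auto simp: dist_real_def C_lip g_nonneg)
qed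

lemma C_m_le: "t < T \<Longrightarrow> C t (m t) \<le> C t x"
  using coercive_argmin_Inf[OF C_cont C_top C_bot] by (simp add: Cmin_def)

lemma C_inc: "t < T \<Longrightarrow> m t \<le> x \<Longrightarrow> x \<le> y \<Longrightarrow> C t x \<le> C t y"
  by (rule convex_increasing_right[OF C_convex C_m_le])

lemma C_dec: "t < T \<Longrightarrow> x \<le> y \<Longrightarrow> y \<le> m t \<Longrightarrow> C t y \<le> C t x"
  by (rule convex_decreasing_left[OF C_convex C_m_le])

lemma n0_bounds: "z (n0 C th t) < m t" "m t \<le> z (n0 C th t + 1)"
proof -
  obtain i where i: "z i < m t" "m t \<le> z (i + 1)" using zg_ceiling[OF th_pos] .
  have "z (n0 C th t) < m t \<and> m t \<le> z (n0 C th t + 1)"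
    unfolding n0_def
  proof (rule theI[of _ i])
    fix j assume "z j < m t \<and> m t \<le> z (j + 1)"
    then have "z j < z (i + 1)" "z i < z (j + 1)" using i by linarith+
    then show "j = i" using th_pos by (simp add: zg_less)
  qed (use i in simp)
  then show "z (n0 C th t) < m t" "m t \<le> z (n0 C th t + 1)" by auto
qed

lemma grid_in_top:
  assumes "eventually P at_top" obtains i where "P (z i)"
proof -
  obtain B where B: "\<And>x. B \<le> x \<Longrightarrow> P x" using assms by (auto simp: eventually_at_top_linorder)
  obtain i where "B \<le> z (i + 1)" using zg_ceiling[OF th_pos] by metis
  then show ?thesis using that B by blast
qed

lemma grid_in_bot:
  assumes "eventually P at_bot" obtains i where "P (z i)"
proof -
  obtain B where B: "\<And>x. x \<le> B \<Longrightarrow> P x" using assms by (auto simp: eventually_at_bot_linorder)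
  obtain i where "z i \<le> B" using zg_floor[OF th_pos] by metis
  then show ?thesis using that B by blast
qed

text \<open>Coercivity makes the defining set nonempty and \<open>m t\<close> bounds it below, so
  its infimum, being taken over grid points, is attained.\<close>

lemma U_props:
  assumes t: "t < T"
  shows "U t \<in> Z" "m t \<le> U t" "C t (z (n0 C th t)) + K t < C t (U t)"
proof -
  let ?X = "{z i | i. z i \<ge> m t \<and> C t (z i) > C t (z (n0 C th t)) + K t}"
  have "\<forall>\<^sub>F x in at_top. m t \<le> x \<and> C t (z (n0 C th t)) + K t < C t x"
    using C_top[OF t] eventually_ge_at_top
    by (auto simp: filterlim_at_top_dense intro: eventually_conj)
  then obtain i where "m t \<le> z i \<and> C t (z (n0 C th t)) + K t < C t (z i)"
    by (rule grid_in_top)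
  then have "?X \<noteq> {}" by blast
  moreover have "bdd_below ?X" by (rule bdd_belowI[of _ "m t"]) auto
  ultimately have "U t \<in> ?X"
    unfolding SU_def by (intro grid_Inf_mem[OF th_pos]) auto
  then show "U t \<in> Z" "m t \<le> U t" "C t (z (n0 C th t)) + K t < C t (U t)" by auto
qed

text \<open>Justifies the choice in \<open>sLast\<close>: to the left of its minimizer the
  continuous \<open>C (T - 1)\<close> climbs to infinity, so it takes the value minimum plus
  \<open>K (T - 1)\<close>.\<close>

lemma s_last:
  shows "s (T - 1) \<le> m (T - 1)" "C (T - 1) (s (T - 1)) = C (T - 1) (m (T - 1)) + K (T - 1)"
proof -
  have t: "T - 1 < T" using T2 by simp
  obtain b where b: "\<And>x. x \<le> b \<Longrightarrow> C (T - 1) (m (T - 1)) + K (T - 1) \<le> C (T - 1) x"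
    using C_bot[OF t, unfolded filterlim_at_top] by (auto simp: eventually_at_bot_linorder)
  have "\<exists>x\<ge>min b (m (T - 1)). x \<le> m (T - 1) \<and> C (T - 1) x = C (T - 1) (m (T - 1)) + K (T - 1)"
    by (rule IVT2') (use b K_nonneg[OF t] continuous_on_subset[OF C_cont[OF t]] in auto)
  then have "\<exists>x. x \<le> m (T - 1) \<and> C (T - 1) x = C (T - 1) (m (T - 1)) + K (T - 1)" by blast
  from someI_ex[OF this] show "s (T - 1) \<le> m (T - 1)"
    "C (T - 1) (s (T - 1)) = C (T - 1) (m (T - 1)) + K (T - 1)"
    by (simp_all add: sg_def sLast_def)
qed

text \<open>The recursions count stages from the end; these identities turn one of their steps into
  a step from \<open>Suc t\<close> to \<open>t\<close>. The third is the second in simplified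
  form.\<close>

lemma index_Suc:
  assumes "Suc t < T"
  shows "T - 1 - t = Suc (T - 1 - Suc t)" "T - 2 - (T - 1 - Suc t) = t" "T - 2 - (T - Suc (Suc t)) = t"
  using assms by auto

lemma I_props:
  shows "I t \<in> Z" "I t < Ib (Suc t) - th" "I t < m t" "I t \<le> z (n0 C th t)"
proof -
  let ?X = "{z i | i. z i < min (Ib (Suc t) - th) (m t)}"
  obtain i where "z i < min (Ib (Suc t) - th) (m t)" using zg_ceiling[OF th_pos] by metis
  then have "?X \<noteq> {}" by blast
  moreover have "bdd_above ?X"
    by (rule bdd_aboveI[of _ "min (Ib (Suc t) - th) (m t)"]) auto
  ultimately have X: "I t \<in> ?X"
    unfolding Ig_def Ifrom_def by (intro grid_Sup_mem[OF th_pos]) auto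
  then show "I t \<in> Z" "I t < Ib (Suc t) - th" "I t < m t" by auto
  \<comment> \<open>This puts \<open>z (n0 C th t)\<close> into the search window of
    \<open>S t\<close>, where it later serves as a competitor.\<close>
  have "I t < z (n0 C th t) + th" using X n0_bounds(2)[of t] by (auto simp: zg_plus1)
  then show "I t \<le> z (n0 C th t)" using X by (intro Z_less) auto
qed

lemma Ib_props:
  assumes t: "Suc t < T"
  shows "Ib t \<in> Z" "Ib t \<le> I t" "C t (I t) + K t < C t (Ib t - th)"
proof -
  let ?X = "{z i | i. z i \<le> I t \<and> C t (z i) > C t (I t) + K t}"
  have "\<forall>\<^sub>F x in at_bot. x \<le> I t \<and> C t (I t) + K t < C t x"
    using C_bot[of t] t eventually_le_at_bot
    by (auto simp: filterlim_at_top_dense intro: eventually_conj)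
  then obtain i where "z i \<le> I t \<and> C t (I t) + K t < C t (z i)" by (rule grid_in_bot)
  then have "?X \<noteq> {}" by blast
  moreover have "bdd_above ?X" by (rule bdd_aboveI[of _ "I t"]) auto
  ultimately have "Sup ?X \<in> ?X" by (intro grid_Sup_mem[OF th_pos]) auto
  moreover have "Ib t = Sup ?X + th"
    unfolding Ibar_def index_Suc(1)[OF t] Ibar_aux.simps Let_def index_Suc(2,3)[OF t] Ig_def ..
  ultimately have X: "Ib t - th \<in> ?X" by simp
  then show "C t (I t) + K t < C t (Ib t - th)" by auto
  show "Ib t \<in> Z" using Z_add(2)[of "Ib t - th"] X by auto
  \<comment> \<open>Equality would contradict \<open>C t (I t) + K t < C t (Ib t - th)\<close>, as
    \<open>K t\<close> is nonnegative. Hence adding \<open>th\<close> does not carry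
    \<open>Ib t\<close> past \<open>I t\<close>.\<close>
  have "Ib t - th \<noteq> I t" using X K_nonneg[of t] t by auto
  then have "Ib t - th < I t" using X by auto
  then show "Ib t \<le> I t" using \<open>Ib t \<in> Z\<close> I_props(1) by (intro Z_less) auto
qed

lemma H_last: "H (T - 1) = C (T - 1)" "S (T - 1) = m (T - 1)" "Ib (T - 1) = s (T - 1)"
  by (simp_all add: Hg_def Sg_def sg_def Ibar_def)

lemma HSs_Suc:
  assumes t: "Suc t < T"
  defines "Gr \<equiv> {z i | i. I t \<le> z i \<and> z i \<le> U t}"
  shows "H t = (\<lambda>y. C t y + a * av t (V (Suc t)) y)"
    and "S t = Max {x \<in> Gr. H t x = Min (H t ` Gr)}"
    and "s t = (if K t = 0 then S t
               else Min {z i | i. Ib t \<le> z i \<and> z i \<le> S t \<and> H t (z i) \<le> H t (S t) + K t})"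
proof -
  let ?p = "HSs_aux T a K C F th (T - 1 - Suc t)"
  have p: "?p = (H (Suc t), S (Suc t), s (Suc t))"
    by (simp add: Hg_def Sg_def sg_def)
  have V: "Vfrom (H (Suc t)) (S (Suc t)) (s (Suc t)) (K (Suc t)) = V (Suc t)"
    by (simp add: Vg_def fun_eq_iff)
  note e = index_Suc(1)[OF t] HSs_aux.simps index_Suc(2)[OF t] p Let_def prod.case V
  have H: "H t = (\<lambda>y. C t y + a * av t (V (Suc t)) y)"
    unfolding Hg_def[of T a K C F th t] e fst_conv av_def ..
  have S: "S t = Max {x \<in> Gr. H t x = Min (H t ` Gr)}"
    unfolding Sg_def[of T a K C F th t] e fst_conv snd_conv H av_def Gr_def ..
  show "H t = (\<lambda>y. C t y + a * av t (V (Suc t)) y)" "S t = Max {x \<in> Gr. H t x = Min (H t ` Gr)}"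
    by fact+
  show "s t = (if K t = 0 then S t
               else Min {z i | i. Ib t \<le> z i \<and> z i \<le> S t \<and> H t (z i) \<le> H t (S t) + K t})"
    unfolding sg_def[of T a K C F th t] e fst_conv snd_conv H S av_def Gr_def ..
qed


subsection \<open>Invariants of the backward recursion\<close>

text \<open>The finite sum in the definition is the whole series, since \<open>p x\<close> vanishes
  below \<open>s (Suc t)\<close>. In this form all estimates can be averaged by the rules for
  \<open>av\<close>.\<close>

lemma psi_from_eq:
  assumes t: "Suc t < T" and zero: "\<And>u. u < s (Suc t) \<Longrightarrow> p x u = 0"
  shows "psi_from T a K C F th g t p x y = g t * x + a * av t (p x) y"
proof (cases "y < s (Suc t) - th")
  case True
  \<comment> \<open>The largest argument is \<open>y + th\<close>, at index -1, and it is still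
    below \<open>s (Suc t)\<close>.\<close>
  have "p x (y - z (int n - 1)) = 0" for n
  proof (rule zero)
    have "z (-1) \<le> z (int n - 1)" using th_pos by (simp add: zg_mono)
    then show "y - z (int n - 1) < s (Suc t)" using True by (simp add: zg_def)
  qed
  then show ?thesis using True by (simp add: psi_from_def Let_def av_def)
next
  case False
  define N where "N = nidx th (s (Suc t)) y"
  have N: "y - s (Suc t) < z N"
    unfolding N_def nidx_eq[OF th_pos] using floor_divide_upper[OF th_pos] by (auto simp: zg_def)
  let ?f = "\<lambda>n. p x (y - z n) * fg F th t n"
  have "av t (p x) y = (\<Sum>n<nat (N + 1). ?f (int n - 1))"
    unfolding av_def
  proof (rule suminf_finite)
    fix n assume "n \<notin> {..<nat (N + 1)}"
    then have "z N \<le> z (int n - 1)" using th_pos by (simp add: zg_mono)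
    then have "p x (y - z (int n - 1)) = 0" using N by (intro zero) simp
    then show "?f (int n - 1) = 0" by simp
  qed simp
  also have "\<dots> = (\<Sum>n\<in>{-1..N - 1}. ?f n)"
    by (rule sum.reindex_bij_witness[of _ "\<lambda>i. nat (i + 1)" "\<lambda>n. int n - 1"]) auto
  finally show ?thesis using False by (simp add: psi_from_def Let_def N_def)
qed

lemma phi_rec:
  assumes t: "Suc t < T"
  shows "\<phi> t x y = (if y < s t then 0 else if y - x < s t then \<psi> t (y - s t) y else \<psi> t x y)"
proof -
  have "\<psi> t = psi_from T a K C F th g t (\<phi> (Suc t))" using t by (auto simp: psi_def)
  then show ?thesis
    unfolding phi_def[of T a K C F th g t] index_Suc(1)[OF t] phi_aux.simps index_Suc(2)[OF t]
    by (simp add: phi_from_def Let_def phi_def)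
qed

lemma phibar_rec:
  assumes t: "Suc t < T"
  shows "\<phi>b t x y = (if y < s t then 0 else if y - x < s t then \<psi>b t (y - s t + th) y else \<psi>b t x y)"
proof -
  have "\<psi>b t = psi_from T a K C F th g t (\<phi>b (Suc t))" using t by (auto simp: psibar_def)
  then show ?thesis
    unfolding phibar_def[of T a K C F th g t] index_Suc(1)[OF t] phibar_aux.simps index_Suc(2)[OF t]
    by (simp add: phibar_from_def Let_def phibar_def)
qed

definition stage_ok :: "nat \<Rightarrow> bool" where
  "stage_ok t \<longleftrightarrow>
    (\<forall>x y. 0 \<le> x \<longrightarrow> V t y - V t (y - x) \<le> \<phi> t x y) \<and>
    (\<forall>x x' y y'. 0 \<le> x \<longrightarrow> x \<le> x' \<longrightarrow> y \<le> y' \<longrightarrow> \<phi> t x y \<le> \<phi> t x' y') \<and>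
    (\<forall>x y. y < s t \<longrightarrow> \<phi> t x y = 0) \<and>
    (\<forall>i x. z i \<le> x \<longrightarrow> x \<le> z (i + 1) \<longrightarrow>
       \<bar>2 * V t x - V t (z i) - V t (z (i + 1))\<bar> \<le> \<phi>b t th (z (i + 1))) \<and>
    (\<forall>i j. i \<le> j \<longrightarrow> \<phi>b t th (z i) \<le> \<phi>b t th (z j)) \<and>
    (\<forall>y. y < s t \<longrightarrow> \<phi>b t th y = 0) \<and>
    kconvex_on Z (K t) (V t) \<and>
    (\<forall>x\<in>Z. \<forall>y\<in>Z. x \<le> y \<longrightarrow> V t x \<le> K t + V t y) \<and>
    Ib t \<le> s t"

lemma stage_okD:
  assumes "stage_ok t"
  shows "0 \<le> x \<Longrightarrow> V t y - V t (y - x) \<le> \<phi> t x y"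
    and "0 \<le> x \<Longrightarrow> x \<le> x' \<Longrightarrow> y \<le> y' \<Longrightarrow> \<phi> t x y \<le> \<phi> t x' y'"
    and "y < s t \<Longrightarrow> \<phi> t x y = 0"
    and "z i \<le> x \<Longrightarrow> x \<le> z (i + 1) \<Longrightarrow>
       \<bar>2 * V t x - V t (z i) - V t (z (i + 1))\<bar> \<le> \<phi>b t th (z (i + 1))"
    and "i \<le> j \<Longrightarrow> \<phi>b t th (z i) \<le> \<phi>b t th (z j)"
    and "y < s t \<Longrightarrow> \<phi>b t th y = 0"
    and "kconvex_on Z (K t) (V t)"
    and "x \<in> Z \<Longrightarrow> y \<in> Z \<Longrightarrow> x \<le> y \<Longrightarrow> V t x \<le> K t + V t y"
    and "Ib t \<le> s t"
proof -
  note c1 = assms[unfolded stage_ok_def]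
  note c2 = c1[THEN conjunct2]
  note c3 = c2[THEN conjunct2]
  note c4 = c3[THEN conjunct2]
  note c5 = c4[THEN conjunct2]
  note c6 = c5[THEN conjunct2]
  note c7 = c6[THEN conjunct2]
  note c8 = c7[THEN conjunct2]
  note c9 = c8[THEN conjunct2]
  show "V t y - V t (y - x) \<le> \<phi> t x y" if "0 \<le> x"
    using that c1[THEN conjunct1] by blast
  show "\<phi> t x y \<le> \<phi> t x' y'" if "0 \<le> x" "x \<le> x'" "y \<le> y'"
    using that c2[THEN conjunct1] by blast
  show "\<phi> t x y = 0" if "y < s t"
    using that c3[THEN conjunct1] by blast
  show "\<bar>2 * V t x - V t (z i) - V t (z (i + 1))\<bar> \<le> \<phi>b t th (z (i + 1))" if "z i \<le> x" "x \<le> z (i + 1)"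
    using that c4[THEN conjunct1] by blast
  show "\<phi>b t th (z i) \<le> \<phi>b t th (z j)" if "i \<le> j"
    using that c5[THEN conjunct1] by blast
  show "\<phi>b t th y = 0" if "y < s t"
    using that c6[THEN conjunct1] by blast
  show "kconvex_on Z (K t) (V t)"
    using c7[THEN conjunct1] by blast
  show "V t x \<le> K t + V t y" if "x \<in> Z" "y \<in> Z" "x \<le> y"
    using that c8[THEN conjunct1] by blast
  show "Ib t \<le> s t"
    using c9 by blast
qed

lemma V_below: "y < s t \<Longrightarrow> V t y = H t (S t) + K t"
  and V_above: "s t \<le> y \<Longrightarrow> V t y = H t y"
  by (simp_all add: Vg_def Vfrom_def)

lemma V_eq: "V t = Vfrom (H t) (S t) (s t) (K t)"
  by (simp add: Vg_def fun_eq_iff)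

text \<open>Here \<open>s\<close> need not be a grid point, but \<open>C\<close> takes at
  \<open>s\<close> exactly the order value, so \<open>V\<close> is continuous: constant up to
  \<open>s\<close> and Lipschitz beyond. The bound \<open>lip\<close> then yields both the growth
  and the cell estimate.\<close>

lemma stage_ok_last: "stage_ok (T - 1)"
proof -
  define r where "r = T - 1"
  have r: "r < T" using T2 by (simp add: r_def)
  note [simp] = H_last[folded r_def]
  note sl = s_last[folded r_def]
  have phi: "\<phi> r x y = (if y < s r then 0 else g r * x)" "\<phi>b r x y = (if y < s r then 0 else g r * x)" for x y
    by (simp_all add: phi_def phibar_def r_def)
  have mono: "g r * x \<le> g r * x'" if "x \<le> x'" for x x'
    using that g_nonneg[OF r] by (rule mult_left_mono)
  have lip: "\<bar>V r x - V r y\<bar> \<le> (if y < s r then 0 else g r * (y - x))" if "x \<le> y" for x y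
  proof -
    consider "y < s r" | "x < s r" "s r \<le> y" | "s r \<le> x" by linarith
    then show ?thesis
    proof cases
      case 2
      have "\<bar>C r (s r) - C r y\<bar> \<le> g r * \<bar>s r - y\<bar>" by (rule C_lip[OF r])
      also have "\<dots> \<le> g r * (y - x)" using 2 by (intro mono) simp
      finally show ?thesis using 2 sl by (simp add: V_below V_above)
    qed (use that C_lip[OF r, of x y] in \<open>auto simp: V_below V_above\<close>)
  qed
  have kc: "kconvex_on UNIV (K r) (H r)"
    using convex_imp_kconvex[OF C_convex K_nonneg] r by simp
  have sS: "H r (s r) \<le> H r (S r) + K r" and min: "\<And>x. H r (S r) \<le> H r x"
    using sl C_m_le[OF r] by simp_all
  show ?thesis
    unfolding stage_ok_def r_def[symmetric]
  proof (intro conjI allI ballI impI)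
    fix x y :: real assume "0 \<le> x"
    then show "V r y - V r (y - x) \<le> \<phi> r x y" using lip[of "y - x" y] by (auto simp: phi)
  next
    fix x x' y y' :: real assume "0 \<le> x" "x \<le> x'" "y \<le> y'"
    then show "\<phi> r x y \<le> \<phi> r x' y'" using mono[of x x'] mono[of 0 x'] by (auto simp: phi)
  next
    fix i x assume x: "z i \<le> x" "x \<le> z (i + 1)"
    have "\<bar>2 * V r x - V r (z i) - V r (z (i + 1))\<bar>
        \<le> \<bar>V r (z i) - V r x\<bar> + \<bar>V r x - V r (z (i + 1))\<bar>" by linarith
    also have "\<dots> \<le> \<phi>b r th (z (i + 1))"
    proof (cases "z (i + 1) < s r")
      case False
      have "\<bar>V r (z i) - V r x\<bar> \<le> g r * (x - z i)"
        using lip[OF x(1)] mono[of 0 "x - z i"] x by (auto split: if_splits)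
      moreover have "\<bar>V r x - V r (z (i + 1))\<bar> \<le> g r * (z (i + 1) - x)"
        using lip[OF x(2)] False by auto
      moreover have "g r * (x - z i) + g r * (z (i + 1) - x) = g r * th"
        unfolding zg_plus1 by (simp add: algebra_simps)
      ultimately show ?thesis using False by (simp add: phi)
    qed (use x lip[OF x(1)] lip[OF x(2)] in \<open>auto simp: phi\<close>)
    finally show "\<bar>2 * V r x - V r (z i) - V r (z (i + 1))\<bar> \<le> \<phi>b r th (z (i + 1))" .
  next
    fix i j :: int assume "i \<le> j"
    then have "z i \<le> z j" using th_pos by (simp add: zg_mono)
    then show "\<phi>b r th (z i) \<le> \<phi>b r th (z j)" using mono[of 0 th] th_pos by (auto simp: phi)
  next
    show "kconvex_on Z (K r) (V r)"
      unfolding V_eq using kconvex_Vfrom[OF kc _ K_nonneg[OF r] sS min] kconvex_on_subset by blast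
  next
    fix x y :: real assume "x \<le> y"
    then show "V r x \<le> K r + V r y"
      unfolding V_eq using Vfrom_le[OF kc _ _ _ _ K_nonneg[OF r] sS min] by blast
  qed (auto simp: phi)
qed

section \<open>One backward step from stage t + 1 to stage t\<close>

context
  fixes t assumes t: "Suc t < T" and ok: "stage_ok (Suc t)"
begin

lemma t_less: "t < T" using t by simp

lemma H_eq: "H t y = C t y + a * av t (V (Suc t)) y"
  by (simp add: HSs_Suc(1)[OF t])

lemma left_const_phi: "left_const (\<phi> (Suc t) x)" "left_const (\<phi>b (Suc t) th)"
  by (rule left_constI[of "s (Suc t)"], simp add: stage_okD[OF ok])+

text \<open>By monotonicity in the second argument it suffices to compare with a point below
  \<open>s (Suc t)\<close>, where \<open>\<phi>\<close> vanishes.\<close>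

lemma phi_nonneg: "0 \<le> x \<Longrightarrow> 0 \<le> \<phi> (Suc t) x y"
  using stage_okD(2)[OF ok, of x x "min y (s (Suc t) - 1)" y] stage_okD(3)[OF ok, of "min y (s (Suc t) - 1)" x]
  by simp

lemma psi_eq: "\<psi> t x y = g t * x + a * av t (\<phi> (Suc t) x) y"
proof -
  have "\<psi> t = psi_from T a K C F th g t (\<phi> (Suc t))" using t by (auto simp: psi_def)
  then show ?thesis using psi_from_eq[where p = "\<phi> (Suc t)", OF t stage_okD(3)[OF ok]] by simp
qed

lemma psibar_eq: "\<psi>b t th y = g t * th + a * av t (\<phi>b (Suc t) th) y"
proof -
  have "\<psi>b t = psi_from T a K C F th g t (\<phi>b (Suc t))" using t by (auto simp: psibar_def)
  then show ?thesis
    using psi_from_eq[where p = "\<phi>b (Suc t)" and x = th, OF t stage_okD(6)[OF ok]] by simp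
qed

lemma psi_mono:
  assumes "0 \<le> x" "x \<le> x'" "y \<le> y'"
  shows "\<psi> t x y \<le> \<psi> t x' y'"
proof -
  have "av t (\<phi> (Suc t) x) y \<le> av t (\<phi> (Suc t) x') y'"
    using assms by (intro av_mono t_less left_const_phi stage_okD(2)[OF ok]) auto
  then show ?thesis unfolding psi_eq
    using assms a_pos g_nonneg[OF t_less] by (intro add_mono mult_left_mono) auto
qed

lemma psi_nonneg: "0 \<le> x \<Longrightarrow> 0 \<le> \<psi> t x y"
proof -
  assume x: "0 \<le> x"
  have "0 = av t (\<lambda>_. 0) y" using av_const[OF t_less] by simp
  also have "\<dots> \<le> av t (\<phi> (Suc t) x) y"
    using x by (intro av_mono t_less left_const_phi phi_nonneg) (auto simp: left_const_def)
  finally show ?thesis unfolding psi_eq using x a_pos g_nonneg[OF t_less] by simp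
qed

lemma psibar_mono:
  assumes "i \<le> j"
  shows "\<psi>b t th (z i) \<le> \<psi>b t th (z j)"
proof -
  have "av t (\<phi>b (Suc t) th) (z i) \<le> av t (\<phi>b (Suc t) th) (z j)"
    using assms by (intro av_mono t_less left_const_phi) (simp add: zg_diff stage_okD(5)[OF ok])
  then show ?thesis
    unfolding psibar_eq using a_pos by (intro add_left_mono mult_left_mono) auto
qed

lemma H_increase:
  assumes "0 \<le> x"
  shows "H t y - H t (y - x) \<le> \<psi> t x y"
proof -
  have "av t (V (Suc t)) y \<le> av t (V (Suc t)) (y - x) + av t (\<phi> (Suc t) x) y"
  proof (rule av_le_add[OF t_less left_const_V left_const_V left_const_phi(1)])
    show "V (Suc t) (y - z n) \<le> V (Suc t) (y - x - z n) + \<phi> (Suc t) x (y - z n)" for n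
      using stage_okD(1)[OF ok assms, of "y - z n"] by (simp add: algebra_simps)
  qed
  then have "a * av t (V (Suc t)) y \<le> a * (av t (V (Suc t)) (y - x) + av t (\<phi> (Suc t) x) y)"
    using a_pos by simp
  moreover have "C t y - C t (y - x) \<le> g t * x"
    using C_lip[OF t_less, of y "y - x"] assms by simp
  ultimately show ?thesis unfolding H_eq psi_eq by (simp add: algebra_simps)
qed

lemma H_cell:
  assumes x: "z i \<le> x" "x \<le> z (i + 1)"
  shows "\<bar>2 * H t x - H t (z i) - H t (z (i + 1))\<bar> \<le> \<psi>b t th (z (i + 1))"
proof -
  let ?V = "V (Suc t)" and ?v = "av t (V (Suc t))" and ?p = "av t (\<phi>b (Suc t) th) (z (i + 1))"
  \<comment> \<open>Shifting by \<open>z n\<close> carries cell \<open>i\<close> onto cell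
    \<open>i - n\<close>, so the estimate of the next stage applies termwise.\<close>
  have cell: "\<bar>2 * ?V (x - z n) - ?V (z i - z n) - ?V (z (i + 1) - z n)\<bar> \<le> \<phi>b (Suc t) th (z (i + 1) - z n)" for n
    using stage_okD(4)[OF ok, of "i - n" "x - z n"] x by (simp add: zg_diff[symmetric] zg_plus1 algebra_simps)
  have lc: "left_const (\<lambda>u. ?V u + ?V (u + d))" for d
    by (rule left_constI[of "min (s (Suc t)) (s (Suc t) - d)" _ "2 * (H (Suc t) (S (Suc t)) + K (Suc t))"])
       (simp add: V_below)
  \<comment> \<open>Two evaluations of the average are merged into one average at a single base
    point, so that \<open>av_le_add\<close> can compare sums of two values.\<close>
  have sum: "av t (\<lambda>u. ?V u + ?V (u + (y' - y))) y = ?v y + ?v y'" for y y'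
  proof -
    have "(\<lambda>n. (?V (y - z (int n - 1)) + ?V (y - z (int n - 1) + (y' - y))) * fg F th t (int n - 1))
        sums (?v y + ?v y')"
      using sums_add[OF av_sums[OF t_less left_const_V, of "Suc t" y] av_sums[OF t_less left_const_V, of "Suc t" y']]
      by (simp add: algebra_simps)
    then show ?thesis by (simp add: av_def sums_iff)
  qed
  have "?v x + ?v x \<le> (?v (z i) + ?v (z (i + 1))) + ?p"
    unfolding sum[of x x, symmetric] sum[where y = "z i" and y' = "z (i + 1)", symmetric]
  proof (rule av_le_add[OF t_less lc lc left_const_phi(2)])
    show "?V (x - z n) + ?V (x - z n + (x - x)) \<le> ?V (z i - z n) + ?V (z i - z n + (z (i + 1) - z i))
        + \<phi>b (Suc t) th (z (i + 1) - z n)" for n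
      using cell[of n] by (simp add: algebra_simps)
  qed
  moreover have "?v (z i) + ?v (z (i + 1)) \<le> (?v x + ?v x) + ?p"
    unfolding sum[of x x, symmetric] sum[where y = "z i" and y' = "z (i + 1)", symmetric]
  proof (rule av_le_add[OF t_less lc lc left_const_phi(2)])
    show "?V (z i - z n) + ?V (z i - z n + (z (i + 1) - z i)) \<le> ?V (x - z n) + ?V (x - z n + (x - x))
        + \<phi>b (Suc t) th (z (i + 1) - z n)" for n
      using cell[of n] by (simp add: algebra_simps)
  qed
  ultimately have "\<bar>2 * ?v x - ?v (z i) - ?v (z (i + 1))\<bar> \<le> ?p" by linarith
  then have "a * \<bar>2 * ?v x - ?v (z i) - ?v (z (i + 1))\<bar> \<le> a * ?p" using a_pos by simp
  then have "\<bar>a * (2 * ?v x - ?v (z i) - ?v (z (i + 1)))\<bar> \<le> a * ?p"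
    using a_pos by (simp add: abs_mult)
  moreover have "\<bar>C t x - C t (z i)\<bar> \<le> g t * (x - z i)"
    using C_lip[OF t_less, of x "z i"] x by simp
  moreover have "\<bar>C t x - C t (z (i + 1))\<bar> \<le> g t * (z (i + 1) - x)"
    using C_lip[OF t_less, of x "z (i + 1)"] x by simp
  moreover have "g t * (x - z i) + g t * (z (i + 1) - x) = g t * th"
    unfolding zg_plus1 by (simp add: algebra_simps)
  moreover have "2 * H t x - H t (z i) - H t (z (i + 1)) = (C t x - C t (z i))
      + (C t x - C t (z (i + 1))) + a * (2 * ?v x - ?v (z i) - ?v (z (i + 1)))"
    unfolding H_eq by (simp add: algebra_simps)
  ultimately show ?thesis unfolding psibar_eq by linarith
qed

text \<open>Grid shifts keep the grid, so the average of \<open>V (Suc t)\<close> is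
  \<open>K (Suc t)\<close>-convex there; discounting gives the constant
  \<open>a * K (Suc t)\<close>, at most \<open>K t\<close>, and the convex \<open>C t\<close> adds
  nothing to it.\<close>

lemma kconvex_H: "kconvex_on Z (K t) (H t)"
  unfolding kconvex_on_def
proof (intro ballI impI)
  fix x y w assume Z: "x \<in> Z" "y \<in> Z" "w \<in> Z" and ord: "x \<le> y" "y \<le> w"
  let ?V = "V (Suc t)" and ?v = "av t (V (Suc t))" and ?f = "\<lambda>n. fg F th t (int n - 1)"
  note vs = av_sums[OF t_less left_const_V, of "Suc t"]
  have "(w - x) * ?v y \<le> (w - y) * ?v x + (y - x) * (K (Suc t) * 1 + ?v w)"
  proof (rule sums_le[OF _ sums_mult[OF vs] sums_add[OF sums_mult[OF vs] sums_mult[OF sums_add[OF sums_mult[OF F_sums[OF t_less]] vs]]]])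
    fix n
    let ?d = "z (int n - 1)"
    have "(w - x) * ?V (y - ?d) \<le> (w - y) * ?V (x - ?d) + (y - x) * (K (Suc t) + ?V (w - ?d))"
      using kconvex_onD[OF stage_okD(7)[OF ok], of "x - ?d" "y - ?d" "w - ?d"] Z ord Z_add(1) by simp
    from mult_right_mono[OF this F_nonneg[OF t_less]]
    show "(w - x) * (?V (y - ?d) * ?f n) \<le> (w - y) * (?V (x - ?d) * ?f n)
        + (y - x) * (K (Suc t) * ?f n + ?V (w - ?d) * ?f n)"
      by (simp add: algebra_simps)
  qed
  then have "a * ((w - x) * ?v y) \<le> a * ((w - y) * ?v x + (y - x) * (K (Suc t) + ?v w))"
    using a_pos by simp
  moreover have "(y - x) * (a * K (Suc t)) \<le> (y - x) * K t"
    using ord K_dec[OF t] by (intro mult_left_mono) auto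
  moreover have "(w - x) * C t y \<le> (w - y) * C t x + (y - x) * (0 + C t w)"
    using kconvex_onD[OF convex_imp_kconvex[OF C_convex[OF t_less], of 0 UNIV]] ord by simp
  ultimately show "(w - x) * H t y \<le> (w - y) * H t x + (y - x) * (K t + H t w)"
    unfolding H_eq by (simp add: algebra_simps)
qed

lemma av_V_le:
  assumes "x \<in> Z" "y \<in> Z" "x \<le> y"
  shows "av t (V (Suc t)) x \<le> K (Suc t) + av t (V (Suc t)) y"
proof -
  have "av t (V (Suc t)) x \<le> av t (V (Suc t)) y + av t (\<lambda>_. K (Suc t)) y"
  proof (rule av_le_add[OF t_less left_const_V left_const_V])
    show "V (Suc t) (x - z n) \<le> V (Suc t) (y - z n) + K (Suc t)" for n
      using stage_okD(8)[OF ok, of "x - z n" "y - z n"] assms Z_add(1) by simp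
  qed (simp add: left_const_def)
  then show ?thesis by (simp add: av_const[OF t_less])
qed

text \<open>Even the largest shifted argument, \<open>y + th\<close>, lies below
  \<open>Ib (Suc t)\<close> and hence below \<open>s (Suc t)\<close>, where \<open>V (Suc t)\<close>
  is constant.\<close>

lemma H_below_I:
  assumes "x \<le> y" "y \<le> I t"
  shows "H t x - H t y = C t x - C t y"
proof -
  have "av t (V (Suc t)) x = av t (V (Suc t)) y"
  proof (rule av_cong)
    fix n :: int assume "-1 \<le> n"
    then have "z (-1) \<le> z n" using th_pos by (simp add: zg_mono)
    then have "y - z n < s (Suc t)" "x - z n < s (Suc t)"
      using assms I_props(2)[of t] stage_okD(9)[OF ok] by (auto simp: zg_def)
    then show "V (Suc t) (x - z n) = V (Suc t) (y - z n)" by (simp add: V_below)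
  qed
  then show ?thesis by (simp add: H_eq)
qed

lemma S_props: "S t \<in> Z" "I t \<le> S t" "S t \<le> U t" "x \<in> Z \<Longrightarrow> I t \<le> x \<Longrightarrow> x \<le> U t \<Longrightarrow> H t (S t) \<le> H t x"
proof -
  let ?Gr = "{z i | i. I t \<le> z i \<and> z i \<le> U t}"
  have fin: "finite ?Gr" by (rule finite_grid_Icc[OF th_pos])
  have "I t \<in> ?Gr" using I_props(1,3)[of t] U_props(2)[OF t_less] by auto
  then have "Min (H t ` ?Gr) \<in> H t ` ?Gr" using fin by (intro Min_in) auto
  then obtain y where "y \<in> ?Gr" "H t y = Min (H t ` ?Gr)" by (metis (no_types, lifting) imageE)
  then have "S t \<in> {x \<in> ?Gr. H t x = Min (H t ` ?Gr)}"
    unfolding HSs_Suc(2)[OF t] using fin by (intro Max_in) auto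
  then have S: "S t \<in> ?Gr" "H t (S t) = Min (H t ` ?Gr)" by auto
  then show "S t \<in> Z" "I t \<le> S t" "S t \<le> U t" by auto
  show "H t (S t) \<le> H t x" if "x \<in> Z" "I t \<le> x" "x \<le> U t"
    unfolding S(2) using that fin by (intro Min_le) auto
qed

text \<open>The finite window suffices. Left of \<open>I t\<close>, \<open>H t\<close> is
  \<open>C t\<close> plus a constant and \<open>C t\<close> decreases. Right of \<open>U t\<close>,
  moving to \<open>z (n0 C th t)\<close> saves more than \<open>K t\<close> in \<open>C t\<close>
  and loses at most \<open>a * K (Suc t)\<close> in the future cost.\<close>

lemma S_grid_min:
  assumes x: "x \<in> Z"
  shows "H t (S t) \<le> H t x"
proof -
  consider "x < I t" | "I t \<le> x" "x \<le> U t" | "U t < x" by linarith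
  then show ?thesis
  proof cases
    case 1
    have "H t (I t) \<le> H t x"
      using H_below_I[of x "I t"] C_dec[OF t_less, of x "I t"] 1 I_props(3)[of t] by simp
    moreover have "H t (S t) \<le> H t (I t)"
      using I_props(1,3)[of t] U_props(2)[OF t_less] by (intro S_props(4)) auto
    ultimately show ?thesis by simp
  next
    case 3
    let ?y = "z (n0 C th t)"
    have "?y \<le> x" using n0_bounds(1)[of t] U_props(2)[OF t_less] 3 by simp
    then have "a * av t (V (Suc t)) ?y \<le> a * (K (Suc t) + av t (V (Suc t)) x)"
      using av_V_le[of ?y x] x a_pos by auto
    moreover have "C t ?y + K t < C t x"
      using U_props(2,3)[OF t_less] C_inc[OF t_less, of "U t" x] 3 by simp
    ultimately have "H t ?y \<le> H t x"
      unfolding H_eq using K_dec[OF t] by (simp add: algebra_simps)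
    moreover have "H t (S t) \<le> H t ?y"
      using I_props(4)[of t] n0_bounds(1)[of t] U_props(2)[OF t_less] by (intro S_props(4)) auto
    ultimately show ?thesis by simp
  qed (use x S_props(4) in auto)
qed

text \<open>For the last claim with \<open>K t\<close> positive: between \<open>Ib t\<close> and
  \<open>s t\<close> minimality of \<open>s t\<close> applies; below \<open>Ib t\<close>,
  \<open>C t\<close> exceeds \<open>C t (I t) + K t\<close>, and \<open>H_below_I\<close> transfers
  this to \<open>H t\<close>.\<close>

lemma s_props:
  shows "s t \<in> Z" "Ib t \<le> s t" "s t \<le> S t" "H t (s t) \<le> H t (S t) + K t"
    and "x \<in> Z \<Longrightarrow> x < s t \<Longrightarrow> H t (S t) + K t \<le> H t x"
proof -
  have IbS: "Ib t \<le> S t" using Ib_props(2)[OF t] S_props(2) by simp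
  let ?X = "{z i | i. Ib t \<le> z i \<and> z i \<le> S t \<and> H t (z i) \<le> H t (S t) + K t}"
  have fin: "finite ?X"
    by (rule finite_subset[OF _ finite_grid_Icc[OF th_pos, of "Ib t" "S t"]]) auto
  have SX: "S t \<in> ?X" using IbS S_props(1) K_nonneg[OF t_less] by auto
  have s: "s t = (if K t = 0 then S t else Min ?X)" by (rule HSs_Suc(3)[OF t])
  have "Min ?X \<in> ?X" using fin SX by (intro Min_in) auto
  \<comment> \<open>For \<open>K t = 0\<close> the point \<open>s t = S t\<close> also lies in this
    set, so both branches are covered.\<close>
  then have "s t \<in> ?X" unfolding s using SX by presburger
  then show "s t \<in> Z" "Ib t \<le> s t" "s t \<le> S t" "H t (s t) \<le> H t (S t) + K t" by auto
  show "H t (S t) + K t \<le> H t x" if x: "x \<in> Z" "x < s t"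
  proof (cases "K t = 0")
    case True
    then show ?thesis using S_grid_min[OF x(1)] by simp
  next
    case False
    show ?thesis
    proof (cases "Ib t \<le> x")
      case True
      have "x \<notin> ?X" using fin x s False by (auto simp: not_le dest!: Min_le)
      then have "\<not> (Ib t \<le> x \<and> x \<le> S t \<and> H t x \<le> H t (S t) + K t)" using x(1) by blast
      then show ?thesis using True x \<open>s t \<le> S t\<close> by auto
    next
      case False
      let ?y = "Ib t - th"
      have yI: "?y \<le> I t" using Ib_props(2)[OF t] th_pos by simp
      have "x \<le> ?y" using False x Z_add(3)[OF Ib_props(1)[OF t]] by (intro Z_less) auto
      then have "C t ?y \<le> C t x" using yI I_props(3)[of t] by (intro C_dec[OF t_less]) auto
      then have "H t (I t) + K t \<le> H t x"
        using H_below_I[of x "I t"] \<open>x \<le> ?y\<close> yI Ib_props(3)[OF t] by simp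
      then show ?thesis using S_grid_min[OF I_props(1)] by (meson add_le_cancel_right order_trans)
    qed
  qed
qed

lemma stage_ok_step: "stage_ok t"
  unfolding stage_ok_def
proof (intro conjI allI ballI impI)
  fix x y :: real assume x: "0 \<le> x"
  consider "y < s t" | "s t \<le> y" "y - x < s t" | "s t \<le> y - x" by linarith
  then show "V t y - V t (y - x) \<le> \<phi> t x y"
  proof cases
    case 2
    \<comment> \<open>The value at \<open>y - x\<close> is the order value, which is at least
      \<open>H t (s t)\<close>; thus only the increase of \<open>H t\<close> from \<open>s t\<close>
      to \<open>y\<close> counts, which explains the argument \<open>y - s t\<close> in
      \<open>\<phi>\<close>.\<close>
    then show ?thesis using H_increase[of "y - s t" y] s_props(4)
      by (simp add: phi_rec[OF t] V_below V_above)
  qed (use x H_increase[OF x, of y] in \<open>simp_all add: phi_rec[OF t] V_below V_above\<close>)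
next
  fix x x' y y' :: real assume le: "0 \<le> x" "x \<le> x'" "y \<le> y'"
  \<comment> \<open>The two branches above \<open>s t\<close> are a single \<open>\<psi>\<close>
    with first argument capped at \<open>v - s t\<close>, which makes monotonicity visible.\<close>
  have phi: "\<phi> t u v = (if v < s t then 0 else \<psi> t (min u (v - s t)) v)" for u v
    by (auto simp: phi_rec[OF t] min_def)
  show "\<phi> t x y \<le> \<phi> t x' y'"
    unfolding phi using le by (auto intro!: psi_mono psi_nonneg)
next
  fix x y assume "y < s t"
  then show "\<phi> t x y = 0" by (simp add: phi_rec[OF t])
next
  \<comment> \<open>On the grid the middle branch occurs only at \<open>v = s t\<close>, where its
    argument \<open>v - s t + th\<close> equals \<open>th\<close>.\<close>
  have phib: "\<phi>b t th v = (if v < s t then 0 else \<psi>b t th v)" if "v \<in> Z" for v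
  proof -
    have "v = s t" if "s t \<le> v" "v - th < s t"
      using that Z_less[OF \<open>v \<in> Z\<close> s_props(1)] by simp
    then show ?thesis by (auto simp: phibar_rec[OF t])
  qed
  have psib0: "0 \<le> \<psi>b t th (z i)" for i
    using H_cell[of "i - 1" "z i"] th_pos by (auto simp: zg_mono)
  show "\<phi>b t th (z i) \<le> \<phi>b t th (z j)" if "i \<le> j" for i j
  proof -
    have "z i \<le> z j" using that th_pos by (simp add: zg_mono)
    then show ?thesis using psibar_mono[OF that] psib0 by (auto simp: phib)
  qed
  fix i x assume x: "z i \<le> x" "x \<le> z (i + 1)"
  \<comment> \<open>Since \<open>s t\<close> is a grid point, it is never interior to a
    cell.\<close>
  consider "z (i + 1) < s t" | "z (i + 1) = s t" | "s t \<le> z i"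
    using Z_less[OF s_props(1), of "z i"] by (fastforce simp: zg_plus1)
  then show "\<bar>2 * V t x - V t (z i) - V t (z (i + 1))\<bar> \<le> \<phi>b t th (z (i + 1))"
  proof cases
    case 1
    then show ?thesis using x by (simp add: phib V_below)
  next
    case 2
    have zi: "z i < s t" using 2[symmetric] th_pos by (simp add: zg_plus1)
    \<comment> \<open>Here \<open>V t\<close> may jump at \<open>s t\<close>. The order value lies
      between \<open>H t (s t)\<close> and \<open>H t (z i)\<close>, so the jump is at most the
      difference of these two, which the cell estimate at an endpoint bounds.\<close>
    have "\<bar>H t (z i) - H t (s t)\<bar> \<le> \<psi>b t th (s t)"
      using H_cell[of i "z i"] x 2 by simp
    moreover have "H t (S t) + K t \<le> H t (z i)" using s_props(5)[OF _ zi] by simp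
    moreover note s_props(4)
    ultimately show ?thesis using 2 zi x
      by (cases "x = s t") (auto simp: phib[OF s_props(1)] V_below V_above)
  next
    case 3
    then show ?thesis using H_cell[OF x] x by (simp add: phib V_above)
  qed
next
  fix y assume "y < s t"
  then show "\<phi>b t th y = 0" by (simp add: phibar_rec[OF t])
next
  show "kconvex_on Z (K t) (V t)"
    unfolding V_eq by (rule kconvex_Vfrom[OF kconvex_H s_props(1) K_nonneg[OF t_less] s_props(4) S_grid_min])
next
  fix x y assume "x \<in> Z" "y \<in> Z" "x \<le> y"
  then show "V t x \<le> K t + V t y"
    unfolding V_eq by (rule Vfrom_le[OF kconvex_H s_props(1) _ _ _ K_nonneg[OF t_less] s_props(4) S_grid_min])
qed (rule s_props)

end

lemma stage_ok: "t < T \<Longrightarrow> stage_ok t"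
proof (induction "T - 1 - t" arbitrary: t)
  case 0
  then have "t = T - 1" by simp
  then show ?case using stage_ok_last by simp
next
  case (Suc k)
  then have "Suc t < T" "stage_ok (Suc t)" by auto
  then show ?case by (rule stage_ok_step)
qed


section \<open>Near-optimality of the grid policy off the grid\<close>

context
  fixes t assumes t: "Suc t < T"
begin

lemmas ok_next = stage_ok[OF t]

text \<open>A bound uniform over all cells up to \<open>U t\<close>: \<open>\<psi>b\<close> is
  monotone along the grid and \<open>U t\<close> is a grid point.\<close>

lemma H_cell_U:
  assumes x: "z i \<le> x" "x \<le> z (i + 1)" and U: "z (i + 1) \<le> U t"
  shows "\<bar>2 * H t x - H t (z i) - H t (z (i + 1))\<bar> \<le> \<psi>b t th (U t)"
proof -
  obtain u where u: "U t = z u" using U_props(1)[of t] t by auto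
  then have "i + 1 \<le> u" using U th_pos by (simp add: zg_mono)
  then show ?thesis using H_cell[OF t ok_next x] psibar_mono[OF t ok_next, of "i + 1" u] u by simp
qed

lemma ceiling_cell:
  assumes "y \<le> U t"
  obtains j where "z j < y" "y \<le> z (j + 1)" "z (j + 1) \<le> U t"
proof -
  obtain j where j: "z j < y" "y \<le> z (j + 1)" using zg_ceiling[OF th_pos] .
  have "z (j + 1) < U t + th" using j assms by (simp add: zg_plus1)
  then have "z (j + 1) \<le> U t" using U_props(1)[of t] t by (intro Z_less) auto
  then show ?thesis using that j by blast
qed

text \<open>\<open>H t (S t)\<close> is below the values at both ends of the cell of
  \<open>y\<close>, hence below their mean, which is within half the cell error of
  \<open>H t y\<close>.\<close>

lemma S_near_min:
  assumes y: "y \<le> U t"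
  shows "H t (S t) \<le> H t y + \<psi>b t th (U t)"
proof -
  obtain j where j: "z j < y" "y \<le> z (j + 1)" "z (j + 1) \<le> U t" using ceiling_cell[OF y] .
  show ?thesis
    using H_cell_U[OF _ j(2,3)] j(1) S_grid_min[OF t ok_next, of "z j"] S_grid_min[OF t ok_next, of "z (j + 1)"]
    by auto
qed

text \<open>Rounding both \<open>x\<close> and \<open>y\<close> to the grid would cost twice the cell error. Averaging over the two
  endpoints of each cell costs only half of it at \<open>x\<close> and half of it at \<open>y\<close>.\<close>

lemma V_near_opt:
  assumes xy: "x \<le> y" and y: "y \<le> U t"
  shows "V t x \<le> K t * delta (y - x) + H t y + \<psi>b t th (U t)"
proof (cases "x < s t")
  case True
  show ?thesis
  proof (cases "x = y")
    case True
    obtain j where j: "z j < x" "x \<le> z (j + 1)" "z (j + 1) \<le> U t"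
      using ceiling_cell[of x] xy y by auto
    \<comment> \<open>The left end of the cell is below \<open>s t\<close>, so its value is at least
      the order value. The cell estimates at \<open>x\<close> and at \<open>z j\<close> together
      give that \<open>H t (z j)\<close> exceeds \<open>H t x\<close> by at most one full cell
      error.\<close>
    have "H t (S t) + K t \<le> H t (z j)" using s_props(5)[OF t ok_next, of "z j"] j \<open>x < s t\<close> by simp
    moreover have "\<bar>2 * H t x - H t (z j) - H t (z (j + 1))\<bar> \<le> \<psi>b t th (U t)"
      "\<bar>2 * H t (z j) - H t (z j) - H t (z (j + 1))\<bar> \<le> \<psi>b t th (U t)"
      using H_cell_U[of j x] H_cell_U[of j "z j"] j th_pos by (auto simp: zg_mono)
    ultimately show ?thesis using True \<open>x < s t\<close> by (simp add: V_below delta_def)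
  next
    case False
    then show ?thesis using S_near_min[OF y] True xy by (simp add: V_below delta_def)
  qed
next
  case False
  then have sx: "s t \<le> x" by simp
  have K0: "0 \<le> K t * delta (y - x)" using K_nonneg[of t] t by (simp add: delta_def)
  obtain j where j: "z j < y" "y \<le> z (j + 1)" "z (j + 1) \<le> U t" using ceiling_cell[OF y] .
  obtain i where i: "z i \<le> x" "x < z (i + 1)" using zg_floor[OF th_pos] .
  show ?thesis
  proof (cases "z j \<le> x")
    case True
    \<comment> \<open>Both points lie in one cell, and their estimates share the same endpoint
      values.\<close>
    show ?thesis
      using H_cell_U[OF True _ j(3)] H_cell_U[OF _ j(2,3)] xy j K0 sx by (simp add: V_above)
  next
    case False
    have ij: "z (i + 1) \<le> z j"
      using Z_less[OF rangeI[of z "i + 1"] rangeI[of z j]] i False by (simp add: zg_plus1)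
    have si: "s t \<le> z i" using Z_less[OF s_props(1)[OF t ok_next], of "z i"] i sx by (simp add: zg_plus1)
    have le: "H t v \<le> K t + H t w" if "v \<in> {z i, z (i + 1)}" "w \<in> {z j, z (j + 1)}" for v w
    proof (rule kconvex_no_order[OF kconvex_H[OF t ok_next] s_props(1)[OF t ok_next] _ _ _ _ s_props(4)[OF t ok_next]])
      show "s t \<le> v" "v \<le> w" using that si ij th_pos by (auto simp: zg_plus1)
    qed (use that S_grid_min[OF t ok_next] in auto)
    have "\<bar>2 * H t x - H t (z i) - H t (z (i + 1))\<bar> \<le> \<psi>b t th (U t)"
      using i ij j th_pos by (intro H_cell_U) (auto simp: zg_plus1)
    moreover have "\<bar>2 * H t y - H t (z j) - H t (z (j + 1))\<bar> \<le> \<psi>b t th (U t)"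
      using j by (intro H_cell_U) auto
    \<comment> \<open>Left ends are paired with left ends and right ends with right ends; the two
      inequalities are then averaged.\<close>
    moreover have "H t (z i) \<le> K t + H t (z j)" "H t (z (i + 1)) \<le> K t + H t (z (j + 1))"
      by (auto intro: le)
    moreover have "delta (y - x) = 1" using False j by (simp add: delta_def)
    ultimately show ?thesis using sx by (simp add: V_above)
  qed
qed

section \<open>Monotonicity of the error-bound functions\<close>

lemma omega_eq: "\<omega> t x = \<psi> t th x - g t * th + a * av t (\<omega>b (Suc t)) x"
  using t by (auto simp: omega_def omega_from_def av_def)

lemma omegabar_eq:
  "\<omega>b t x = (if x \<le> U t then \<psi>b t th (U t) + \<omega> t (U t)
     else max (\<psi>b t th (U t) + \<omega> t (U t)) (\<omega> t x))"
proof -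
  have "\<omega> t = omega_from T a K C F th g t (\<omega>b (Suc t))" using t by (auto simp: omega_def)
  then show ?thesis
    unfolding omegabar_def[of T a K C F th g t] index_Suc(1)[OF t] omegabar_aux.simps index_Suc(2)[OF t]
    by (simp add: Let_def omegabar_def)
qed

lemma omega_mono:
  assumes "left_const (\<omega>b (Suc t))" "mono (\<omega>b (Suc t))" "x \<le> y"
  shows "\<omega> t x \<le> \<omega> t y"
proof -
  have "av t (\<omega>b (Suc t)) x \<le> av t (\<omega>b (Suc t)) y"
    using assms t by (intro av_mono monoD[OF assms(2)]) auto
  moreover have "\<psi> t th x \<le> \<psi> t th y" using assms(3) th_pos by (intro psi_mono t ok_next) auto
  ultimately show ?thesis unfolding omega_eq using a_pos by (intro add_mono mult_left_mono) auto
qed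

end

lemma omegabar_last: "\<omega>b (T - 1) x = 0"
  by (simp add: omegabar_def)

text \<open>The maximum in \<open>\<omega>b\<close> continues its constant value at
  \<open>U t\<close>. Left-constancy makes the next average converge; monotonicity lets the error at
  the true position be replaced by that at the rounded one.\<close>

lemma omegabar_mono: "t < T \<Longrightarrow> left_const (\<omega>b t) \<and> mono (\<omega>b t)"
proof (induction "T - 1 - t" arbitrary: t)
  case 0
  then have "t = T - 1" by simp
  then have "\<omega>b t = (\<lambda>_. 0)" using omegabar_last by blast
  then show ?case by (simp add: left_const_def mono_def)
next
  case (Suc k)
  then have t: "Suc t < T" and IH: "left_const (\<omega>b (Suc t))" "mono (\<omega>b (Suc t))" by auto
  have "left_const (\<omega>b t)" by (rule left_constI[of "U t"]) (simp add: omegabar_eq[OF t])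
  moreover have "mono (\<omega>b t)"
    by (rule monoI) (auto simp: omegabar_eq[OF t] max_def dest: omega_mono[OF t IH])
  ultimately show ?case ..
qed

lemma omega_mono_le: "Suc t < T \<Longrightarrow> x \<le> y \<Longrightarrow> \<omega> t x \<le> \<omega> t y"
  using omega_mono omegabar_mono by blast

end

subsection \<open>Comparison with the exact value functions\<close>

lemma fg_Fdist:
  assumes "prob_space M" and D: "D t \<in> borel_measurable M" and th: "0 < th"
  shows "fg (Fdist M D) th t n = measure M {\<omega>\<in>space M. zg th n < D t \<omega> \<and> D t \<omega> \<le> zg th (n + 1)}"
proof -
  interpret prob_space M by fact
  have "{\<omega>\<in>space M. zg th n < D t \<omega> \<and> D t \<omega> \<le> zg th (n + 1)}
      = {\<omega>\<in>space M. D t \<omega> \<le> zg th (n + 1)} - {\<omega>\<in>space M. D t \<omega> \<le> zg th n}"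
    by auto
  moreover have "{\<omega>\<in>space M. D t \<omega> \<le> zg th n} \<subseteq> {\<omega>\<in>space M. D t \<omega> \<le> zg th (n + 1)}"
    using th by (auto simp: zg_plus1)
  ultimately show ?thesis
    using D by (simp add: fg_def Fdist_def finite_measure_Diff)
qed

lemma fg_Fdist_nonneg:
  assumes "prob_space M" "D t \<in> borel_measurable M" "0 < th"
  shows "0 \<le> fg (Fdist M D) th t n"
  unfolding fg_Fdist[where D = D and t = t, OF assms] by simp

text \<open>The half-open cells are disjoint, and for nonnegative demand those from index -1 on
  cover the whole space.\<close>

lemma fg_Fdist_sums:
  assumes M: "prob_space M" and D: "D t \<in> borel_measurable M" and th: "0 < th"
    and nonneg: "\<And>\<omega>. \<omega> \<in> space M \<Longrightarrow> 0 \<le> D t \<omega>"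
  shows "(\<lambda>n. fg (Fdist M D) th t (int n - 1)) sums 1"
proof -
  interpret prob_space M by fact
  let ?A = "\<lambda>n::nat. {\<omega>\<in>space M. zg th (int n - 1) < D t \<omega> \<and> D t \<omega> \<le> zg th (int n - 1 + 1)}"
  have "disjoint_family ?A"
    unfolding disjoint_family_on_def
  proof (intro ballI impI equals0I)
    fix n n' :: nat and \<omega> assume "n \<noteq> n'" "\<omega> \<in> ?A n \<inter> ?A n'"
    then have "zg th (int n - 1) < zg th (int n' - 1 + 1)" "zg th (int n' - 1) < zg th (int n - 1 + 1)"
      by auto
    then show False using th \<open>n \<noteq> n'\<close> by (simp add: zg_less)
  qed
  moreover have "range ?A \<subseteq> sets M" using D by auto
  ultimately have "(\<lambda>n. prob (?A n)) sums prob (\<Union>n. ?A n)" by (intro finite_measure_UNION) auto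
  moreover have "(\<Union>n. ?A n) = space M"
  proof (intro equalityI subsetI)
    fix \<omega> assume w: "\<omega> \<in> space M"
    obtain i where i: "zg th i < D t \<omega>" "D t \<omega> \<le> zg th (i + 1)" using zg_ceiling[OF th] .
    have "zg th 0 \<le> zg th (i + 1)" using i nonneg[OF w] by (simp add: zg_def)
    then have "int (nat (i + 1)) - 1 = i" using th by (simp add: zg_mono)
    then have "\<omega> \<in> ?A (nat (i + 1))" using i w by simp
    then show "\<omega> \<in> (\<Union>n. ?A n)" by blast
  qed auto
  ultimately show ?thesis unfolding fg_Fdist[where D = D and t = t, OF M D th] by (simp add: prob_space)
qed

locale stochastic_dp = grid_dp T a K C "Fdist M D" th g + prob_space M
  for T :: nat and a :: real and K :: "nat \<Rightarrow> real" and C :: "nat \<Rightarrow> real \<Rightarrow> real"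
    and M :: "'a measure" and D :: "nat \<Rightarrow> 'a \<Rightarrow> real" and th :: real and g :: "nat \<Rightarrow> real" +
  assumes D_meas: "t < T \<Longrightarrow> D t \<in> borel_measurable M"
    and D_nonneg: "t < T \<Longrightarrow> w \<in> space M \<Longrightarrow> 0 \<le> D t w"
    and V_int: "t < T \<Longrightarrow> integrable M (\<lambda>w. Vstar T a K C (Expt M D) (Suc t) (y - D t w))"
begin

abbreviation "Vs t \<equiv> Vstar T a K C (Expt M D) t"
abbreviation "Hs t \<equiv> Hstar T a K C (Expt M D) t"

text \<open>The average is the integral of a step function constant on each demand cell, and this
  function lies below \<open>h\<close> pointwise.\<close>

lemma av_le_integral:
  assumes t: "t < T" and q: "left_const q" and h: "integrable M h"
    and le: "\<And>w n. w \<in> space M \<Longrightarrow> z n < D t w \<Longrightarrow> D t w \<le> z (n + 1) \<Longrightarrow> q (x - z n) \<le> h w"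
  shows "av t q x \<le> (\<integral>w. h w \<partial>M)"
proof -
  obtain b c where c: "\<And>u. u < b \<Longrightarrow> q u = c" using q by (auto simp: left_const_def)
  obtain N where N: "\<And>n. n \<ge> N \<Longrightarrow> x - z (int n - 1) < b" using eventually_below by blast
  define A where "A n = {w\<in>space M. z (int n - 1) < D t w \<and> D t w \<le> z (int n - 1 + 1)}" for n :: nat
  \<comment> \<open>Subtracting the limit value \<open>c\<close> leaves only the first
    \<open>N\<close> cells, so the step function is a finite sum plus a constant and its
    integrability is immediate.\<close>
  define p where "p n = q (x - z (int n - 1)) - c" for n :: nat
  have A: "A n \<in> sets M" for n unfolding A_def using D_meas[OF t] by measurable
  have int: "integrable M (\<lambda>w. p n * indicator (A n) w)" for n
    by (intro integrable_mult_right integrable_real_indicator A) (simp add: emeasure_eq_measure)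
  have f: "fg (Fdist M D) th t (int n - 1) = prob (A n)" for n
    unfolding A_def by (rule fg_Fdist[where D = D and t = t, OF prob_space_axioms D_meas[OF t] th_pos])
  have p0: "p n = 0" if "N \<le> n" for n using c N that by (simp add: p_def)
  have "(\<lambda>n. p n * prob (A n)) sums (\<Sum>n<N. p n * prob (A n))"
    by (rule sums_finite) (auto simp: p0)
  from sums_add[OF this sums_mult[OF F_sums[OF t], of c]]
  have "av t q x = (\<Sum>n<N. p n * prob (A n)) + c"
    by (simp add: av_def f p_def algebra_simps sums_iff)
  also have "\<dots> = (\<integral>w. (\<Sum>n<N. p n * indicator (A n) w) + c \<partial>M)"
  proof -
    have "(\<integral>w. (\<Sum>n<N. p n * indicator (A n) w) + c \<partial>M)
        = (\<Sum>n<N. \<integral>w. p n * indicator (A n) w \<partial>M) + (\<integral>w. c \<partial>M)"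
      using int by (simp only: Bochner_Integration.integral_add Bochner_Integration.integral_sum
          Bochner_Integration.integrable_sum integrable_const)
    moreover have "A n \<inter> space M = A n" for n by (auto simp: A_def)
    ultimately show ?thesis using A by (simp add: prob_space)
  qed
  also have "\<dots> \<le> (\<integral>w. h w \<partial>M)"
  proof (rule integral_mono)
    show "integrable M (\<lambda>w. (\<Sum>n<N. p n * indicator (A n) w) + c)"
      by (intro Bochner_Integration.integrable_add Bochner_Integration.integrable_sum int) simp
    fix w assume w: "w \<in> space M"
    obtain i where i: "z i < D t w" "D t w \<le> z (i + 1)" using zg_ceiling[OF th_pos] .
    have "z 0 \<le> z (i + 1)" using i D_nonneg[OF t w] by (simp add: zg_def)
    then have k: "int (nat (i + 1)) - 1 = i" using th_pos by (simp add: zg_mono)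
    define k where "k = nat (i + 1)"
    \<comment> \<open>Each outcome belongs to exactly one cell, so the sum of indicators picks out a
      single term.\<close>
    have ind: "indicator (A n) w = (if n = k then 1 else 0 :: real)" for n
    proof (cases "n = k")
      case False
      have "\<not> (z (int n - 1) < z (i + 1) \<and> z i < z (int n - 1 + 1))"
        using False k unfolding k_def zg_less[OF th_pos] by linarith
      then have "w \<notin> A n" using i by (auto simp: A_def)
      then show ?thesis using False by simp
    qed (use i w k in \<open>simp add: A_def k_def\<close>)
    have "(\<Sum>n<N. p n * indicator (A n) w) = p k"
      using p0[of k] by (simp add: ind if_distrib cong: if_cong)
    then show "(\<Sum>n<N. p n * indicator (A n) w) + c \<le> h w"
      using le[OF w i] k by (simp add: p_def k_def)
  qed fact
  finally show ?thesis .
qed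

section \<open>Order inequalities for the exact problem\<close>

lemma Hs_eq: "Hs t y = C t y + a * (\<integral>w. Vs (Suc t) (y - D t w) \<partial>M)"
  by (simp add: Hstar_def Expt_def)

lemma Vs_T: "Vs T x = 0"
  by (simp add: Vstar_def)

lemma Vs_rec:
  assumes t: "t < T"
  shows "Vs t x = (INF y\<in>{x..}. K t * delta (y - x) + Hs t y)"
proof -
  have "T - t = Suc (T - Suc t)" "T - Suc (T - Suc t) = t" using t by auto
  then show ?thesis by (simp add: Vstar_def Hstar_def)
qed

text \<open>An infimum of reals is a lower bound only when the set is bounded below. A bound
  \<open>b\<close> at the next stage gives the bound \<open>C t (m t) + a * b\<close> here, because
  setup costs are nonnegative.\<close>

lemma Vs_bdd: "t \<le> T \<Longrightarrow> \<exists>b. (\<forall>x. b \<le> Vs t x) \<and> (t < T \<longrightarrow> (\<forall>x. b \<le> Hs t x))"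
proof (induction "T - t" arbitrary: t)
  case 0
  then show ?case using Vs_T by auto
next
  case (Suc k)
  then have t: "t < T" by simp
  with Suc obtain b where b: "\<And>x. b \<le> Vs (Suc t) x" by (metis Suc_diff_Suc Suc_inject Suc_leI)
  have "b \<le> (\<integral>w. Vs (Suc t) (y - D t w) \<partial>M)" for y
    using integral_mono[OF _ V_int[OF t], of "\<lambda>_. b" y] b by (simp add: prob_space)
  then have H: "C t (m t) + a * b \<le> Hs t y" for y
    unfolding Hs_eq using a_pos C_m_le[OF t] by (intro add_mono mult_left_mono) auto
  have "C t (m t) + a * b \<le> Vs t x" for x
    unfolding Vs_rec[OF t]
  proof (rule cINF_greatest)
    show "C t (m t) + a * b \<le> K t * delta (y - x) + Hs t y" for y
      using H[of y] K_nonneg[OF t] by (simp add: delta_def)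
  qed simp
  then show ?case using H by blast
qed

lemma Vs_le:
  assumes t: "t < T" and "x \<le> y"
  shows "Vs t x \<le> K t * delta (y - x) + Hs t y"
  unfolding Vs_rec[OF t]
proof (rule cINF_lower)
  obtain b where b: "\<And>y. b \<le> Hs t y" using Vs_bdd[of t] t by auto
  show "bdd_below ((\<lambda>y. K t * delta (y - x) + Hs t y) ` {x..})"
  proof (rule bdd_belowI2)
    show "b \<le> K t * delta (y - x) + Hs t y" for y
      using b[of y] K_nonneg[OF t] by (simp add: delta_def)
  qed
qed (use assms in simp)

lemma Vs_ge:
  assumes "t < T" "\<And>y. x \<le> y \<Longrightarrow> b \<le> K t * delta (y - x) + Hs t y"
  shows "b \<le> Vs t x"
  unfolding Vs_rec[OF assms(1)] using assms(2) by (intro cINF_greatest) auto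

text \<open>Every level reachable from \<open>y\<close> is reachable from \<open>x\<close> at an
  additional setup cost of at most \<open>K t\<close>.\<close>

lemma Vs_order:
  assumes t: "t < T" and xy: "x \<le> y"
  shows "Vs t x \<le> K t + Vs t y"
proof -
  have "Vs t x - K t \<le> Vs t y"
  proof (rule Vs_ge[OF t])
    fix y' assume "y \<le> y'"
    then have "Vs t x \<le> K t * delta (y' - x) + Hs t y'" using xy by (intro Vs_le[OF t]) auto
    then show "Vs t x - K t \<le> K t * delta (y' - y) + Hs t y'"
      using K_nonneg[OF t] by (auto simp: delta_def split: if_splits)
  qed
  then show ?thesis by simp
qed

text \<open>Subtracting \<open>C t\<close> isolates the discounted future cost, to which
  \<open>Vs_order\<close> applies with \<open>a * K (Suc t)\<close>, at most
  \<open>K t\<close>.\<close>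

lemma Hs_order:
  assumes t: "Suc t < T" and xy: "x \<le> y"
  shows "Hs t x - C t x \<le> K t + (Hs t y - C t y)"
proof -
  have t': "t < T" using t by simp
  have "(\<integral>w. Vs (Suc t) (x - D t w) \<partial>M) \<le> (\<integral>w. K (Suc t) + Vs (Suc t) (y - D t w) \<partial>M)"
    using V_int[OF t'] Vs_order[OF t] xy by (intro integral_mono) auto
  also have "\<dots> = K (Suc t) + (\<integral>w. Vs (Suc t) (y - D t w) \<partial>M)"
    using V_int[OF t'] by (simp add: prob_space)
  finally have "a * (\<integral>w. Vs (Suc t) (x - D t w) \<partial>M) \<le> a * (K (Suc t) + (\<integral>w. Vs (Suc t) (y - D t w) \<partial>M))"
    using a_pos by simp
  then show ?thesis unfolding Hs_eq using K_dec[OF t] by (simp add: algebra_simps)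
qed

section \<open>Propagation of the error bounds\<close>

lemma H_error:
  assumes t: "Suc t < T" and IH: "\<And>x. V (Suc t) x - Vs (Suc t) x \<le> \<omega>b (Suc t) x"
  shows "H t x - Hs t x \<le> \<omega> t x"
proof -
  have t': "t < T" using t by simp
  note ok = stage_ok[OF t]
  note wb = omegabar_mono[OF t]
  \<comment> \<open>The test function subtracts from \<open>V\<close> the rounding error and the
    error of the next stage; on each demand cell it stays below the exact value at the true
    position.\<close>
  let ?q = "\<lambda>u. V (Suc t) u - \<phi> (Suc t) th u - \<omega>b (Suc t) u"
  note sums = av_sums[OF t' left_const_V, of "Suc t" x] av_sums[OF t' left_const_phi(1)[OF t ok], of th x]
    av_sums[OF t' conjunct1[OF wb], of x]
  have q: "left_const ?q"
  proof -
    obtain b c where c: "\<And>u. u < b \<Longrightarrow> \<omega>b (Suc t) u = c" using wb by (auto simp: left_const_def)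
    show ?thesis
      by (rule left_constI[of "min b (s (Suc t))" _ "H (Suc t) (S (Suc t)) + K (Suc t) - c"])
         (simp add: c V_below stage_okD(3)[OF ok])
  qed
  have "av t ?q x = av t (V (Suc t)) x - av t (\<phi> (Suc t) th) x - av t (\<omega>b (Suc t)) x"
    using sums_diff[OF sums_diff[OF sums(1,2)] sums(3)] by (simp add: av_def sums_iff left_diff_distrib)
  moreover have "av t ?q x \<le> (\<integral>w. Vs (Suc t) (x - D t w) \<partial>M)"
  proof (rule av_le_integral[OF t' q V_int[OF t']])
    fix w n assume n: "z n < D t w" "D t w \<le> z (n + 1)"
    have "V (Suc t) (x - z n) - V (Suc t) (x - z n - (D t w - z n)) \<le> \<phi> (Suc t) (D t w - z n) (x - z n)"
      using n by (intro stage_okD(1)[OF ok]) simp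
    also have "\<dots> \<le> \<phi> (Suc t) th (x - z n)"
      using n by (intro stage_okD(2)[OF ok]) (auto simp: zg_plus1)
    finally have "V (Suc t) (x - z n) - \<phi> (Suc t) th (x - z n) \<le> V (Suc t) (x - D t w)" by simp
    moreover have "\<omega>b (Suc t) (x - D t w) \<le> \<omega>b (Suc t) (x - z n)"
      using wb n by (auto dest!: monoD[of _ "x - D t w" "x - z n"])
    ultimately show "?q (x - z n) \<le> Vs (Suc t) (x - D t w)" using IH[of "x - D t w"] by simp
  qed
  ultimately have "a * av t (V (Suc t)) x \<le> a * ((\<integral>w. Vs (Suc t) (x - D t w) \<partial>M)
      + av t (\<phi> (Suc t) th) x + av t (\<omega>b (Suc t)) x)"
    using a_pos by simp
  \<comment> \<open>By \<open>psi_eq\<close>, \<open>\<psi> t th x - g t * th\<close> is exactly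
    \<open>a\<close> times the averaged rounding error.\<close>
  then show ?thesis
    unfolding H_eq[OF t ok] Hs_eq omega_eq[OF t] psi_eq[OF t ok] by (simp add: algebra_simps)
qed

lemma V_error:
  assumes t: "Suc t < T" and Herr: "\<And>x. H t x - Hs t x \<le> \<omega> t x"
  shows "V t x - Vs t x \<le> \<omega>b t x"
proof -
  have t': "t < T" using t by simp
  note ok = stage_ok[OF t]
  let ?e = "\<psi>b t th (U t) + \<omega> t (U t)"
  have near: "V t x \<le> K t * delta (y - x) + Hs t y + ?e" if "x \<le> y" "y \<le> U t" for y
    using V_near_opt[OF t that] Herr[of y] omega_mono_le[OF t that(2)] by simp
  have "V t x - \<omega>b t x \<le> Vs t x"
  proof (rule Vs_ge[OF t'])
    fix y assume xy: "x \<le> y"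
    \<comment> \<open>A level \<open>y\<close> above \<open>U t\<close> is replaced by one no more
      costly in the exact problem: by \<open>m t\<close> if \<open>x\<close> is at most
      \<open>m t\<close>, otherwise by \<open>x\<close> itself. If \<open>x\<close> exceeds
      \<open>U t\<close>, the grid policy does not order either, and the bound for
      \<open>H t\<close> applies directly.\<close>
    consider "y \<le> U t" | "x \<le> m t" "U t < y" | "m t < x" "x \<le> U t" "U t < y" | "U t < x" by linarith
    then show "V t x - \<omega>b t x \<le> K t * delta (y - x) + Hs t y"
    proof cases
      case 1
      then show ?thesis using near[OF xy] xy by (simp add: omegabar_eq[OF t])
    next
      case 2
      have m: "m t \<le> U t" by (rule U_props(2)[OF t'])
      have "C t (m t) + K t < C t y"
        using U_props(3)[OF t'] C_m_le[OF t', of "z (n0 C th t)"] C_inc[OF t' m, of y] 2 by simp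
      then have "Hs t (m t) \<le> Hs t y" using Hs_order[OF t, of "m t" y] m 2 by simp
      moreover have "K t * delta (m t - x) \<le> K t * delta (y - x)"
        using 2 m K_nonneg[OF t'] by (simp add: delta_def)
      ultimately show ?thesis using near[of "m t"] 2 m by (simp add: omegabar_eq[OF t])
    next
      case 3
      have "Hs t x \<le> K t + Hs t y"
        using Hs_order[OF t xy] C_inc[OF t' _ xy] 3 by simp
      then show ?thesis using near[of x] 3 by (simp add: omegabar_eq[OF t] delta_def)
    next
      case 4
      have "Hs t x \<le> K t * delta (y - x) + Hs t y"
      proof (cases "x = y")
        case False
        then show ?thesis
          using Hs_order[OF t xy] C_inc[OF t' _ xy] U_props(2)[OF t'] 4 xy by (simp add: delta_def)
      qed (simp add: delta_def)
      moreover have "V t x = H t x"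
        using s_props(3)[OF t ok] S_props(3)[OF t ok] 4 by (simp add: V_above)
      ultimately show ?thesis using Herr[of x] 4 by (simp add: omegabar_eq[OF t])
    qed
  qed
  then show ?thesis by simp
qed

text \<open>With one stage left the policy is exactly optimal. A level \<open>y\<close> below
  \<open>s\<close> costs at least \<open>C\<close> at \<open>s\<close>, which is already the order
  value; for other \<open>y\<close>, K-convexity on all reals applies.\<close>

lemma errors_last:
  "H (T - 1) x - Hs (T - 1) x \<le> 0" "V (T - 1) x - Vs (T - 1) x \<le> 0"
proof -
  define r where "r = T - 1"
  have r: "r < T" "Suc r = T" using T2 by (auto simp: r_def)
  note [simp] = H_last[folded r_def]
  have Hs: "Hs r y = C r y" for y by (simp add: Hs_eq r(2) Vs_T)
  have "V r x \<le> Vs r x"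
  proof (rule Vs_ge[OF r(1)])
    fix y assume xy: "x \<le> y"
    note sl = s_last[folded r_def]
    have "Vfrom (H r) (S r) (s r) (K r) x \<le> K r + Vfrom (H r) (S r) (s r) (K r) y"
      by (rule Vfrom_le[of UNIV, OF _ _ _ _ xy K_nonneg[OF r(1)]])
         (use convex_imp_kconvex[OF C_convex K_nonneg] r sl C_m_le in auto)
    then have le: "V r x \<le> K r + V r y" by (simp add: V_eq)
    show "V r x \<le> K r * delta (y - x) + Hs r y"
    proof (cases "y < s r")
      case True
      then have "C r (s r) \<le> C r y" using sl(1) by (intro C_dec[OF r(1)]) auto
      then show ?thesis using sl xy True K_nonneg[OF r(1)] by (simp add: Hs V_below delta_def)
    next
      case False
      then show ?thesis using le xy by (cases "x = y") (auto simp: Hs V_above delta_def)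
    qed
  qed
  then show "H (T - 1) x - Hs (T - 1) x \<le> 0" "V (T - 1) x - Vs (T - 1) x \<le> 0"
    using Hs[of x] unfolding r_def[symmetric] by simp_all
qed

lemma error_bounds: "t < T \<Longrightarrow> H t x - Hs t x \<le> \<omega> t x \<and> V t x - Vs t x \<le> \<omega>b t x"
proof (induction "T - 1 - t" arbitrary: t x)
  case 0
  then have "t = T - 1" by simp
  then show ?case using errors_last omegabar_last by (simp add: omega_def)
next
  case (Suc k)
  then have t: "Suc t < T" by simp
  have "V (Suc t) x - Vs (Suc t) x \<le> \<omega>b (Suc t) x" for x
    using Suc.hyps(1)[of "Suc t" x] Suc.hyps(2) t by simp
  then have "H t x - Hs t x \<le> \<omega> t x" for x by (rule H_error[OF t])
  then show ?case using V_error[OF t] by blast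
qed

end

section \<open>The error bounds for the inventory model\<close>

theorem theorem4p2:
  fixes T :: nat and a :: real and c :: "nat \<Rightarrow> real" and K :: "nat \<Rightarrow> real"
    and G :: "nat \<Rightarrow> real \<Rightarrow> real" and M :: "'a measure" and D :: "nat \<Rightarrow> 'a \<Rightarrow> real"
    and th :: real and g :: "nat \<Rightarrow> real"
  defines "C \<equiv> Cfun a c G M D" and "F \<equiv> Fdist M D" and "E \<equiv> Expt M D"
  assumes T2: "2 \<le> T"
    and alpha: "0 < a" "a \<le> 1"
    and Kpos: "\<forall>t<T. 0 \<le> K t"
    and Kdec: "\<forall>t<T - 1. a * K (Suc t) \<le> K t"
    and prob: "prob_space M"
    and Dmeas: "\<forall>t<T. D t \<in> borel_measurable M"
    and Dnonneg: "\<forall>t<T. \<forall>\<omega>\<in>space M. 0 \<le> D t \<omega>"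
    and Dmean: "\<forall>t<T. integrable M (D t)"
    and Dindep: "prob_space.indep_vars M (\<lambda>_. borel) D {..<T}"
    and Vint: "\<forall>t<T. \<forall>y. integrable M (\<lambda>\<omega>. Vstar T a K C E (Suc t) (y - D t \<omega>))"
    and Cconv: "\<forall>t<T. convex_on UNIV (C t)"
    and Ccoerc: "\<forall>t<T. filterlim (C t) at_top at_top \<and> filterlim (C t) at_top at_bot"
    and theta: "0 < th"
    and Lip: "\<forall>t<T. 0 \<le> g t \<and> (\<forall>x y. \<bar>C t x - C t y\<bar> \<le> g t * \<bar>x - y\<bar>)"
  shows "\<forall>t<T. \<forall>x.
           Hg T a K C F th t x - Hstar T a K C E t x \<le> omega T a K C F th g t x
         \<and> Vg T a K C F th t x - Vstar T a K C E t x \<le> omegabar T a K C F th g t x"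
proof -
  have "stochastic_dp T a K C M D th g"
  proof (intro stochastic_dp.intro grid_dp.intro stochastic_dp_axioms.intro)
    fix t assume t: "t < T"
    have D: "D t \<in> borel_measurable M" using Dmeas t by blast
    show "0 \<le> fg (Fdist M D) th t n" for n
      using fg_Fdist_nonneg[where D = D and t = t, OF prob D theta] .
    show "(\<lambda>n. fg (Fdist M D) th t (int n - 1)) sums 1"
      using fg_Fdist_sums[where D = D and t = t, OF prob D theta] Dnonneg t by blast
  qed (use assms in auto)
  then show ?thesis
    unfolding F_def E_def by (auto dest: stochastic_dp.error_bounds)
qed

end
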